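(* Let $R$ be a commutative ring of characteristic $0$, let $p$ be a prime, let $L$ be a $C_p$-Green functor of Lie type over $R$, and let $M$ be an $L$-bimodule. Then there is a one-to-one correspondence between the elements of $\mathrm{Ext}(L,M)$, the set of equivalence classes of $M$-split singular extensions of $L$ by $M$, and the elements of the second Chevalley–Eilenberg cohomology group $H^2_{\mathrm{Green}_{\mathrm{Lie}}(C_p)}(L,M)$.
   Context: Conventions. $R$ is a commutative ring of characteristic $0$; all modules, Lie algebras and (multi)linear maps are over $R$. $C_p$ is the cyclic group of prime order $p$, with subgroups $e$ (trivial) and $C_p$. $C_p$-Mackey functor. A $C_p$-Mackey functor $M$ consists of $R$-modules $M(C_p)$, $M(e)$, $R$-linear maps $r=r_M:M(C_p)\to M(e)$ (restriction) and $t=t_M:M(e)\to M(C_p)$ (transfer), and an $R$-linear action of $C_p$ on $M(e)$ by conjugation maps $c_g:M(e)\to M(e)$, $g\in C_p$ (the conjugations on $M(C_p)$ are the identity), such that $c_g r=r$, $t c_g=t$ for all $g\in C_p$, and $r t=\sum_{g\in C_p}c_g$. A morphism of Mackey functors $f:M\to N$ is a pair of $R$-linear maps $f_{C_p}:M(C_p)\to N(C_p)$, $f_e:M(e)\to N(e)$ commuting with restriction, transfer and conjugation. Exactness is meant at each of $C_p$ and $e$. $C_p$-Green functor of Lie type. A $C_p$-Mackey functor $L$ such that $L(C_p)$ and $L(e)$ are Lie algebras, $r$ and all $c_g$ are Lie algebra homomorphisms, and $[t(a),b]=t[a,r(b)]$, $[b,t(a)]=t[r(b),a]$ for all $a\in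 L(e)$, $b\in L(C_p)$. A morphism of these is a morphism of Mackey functors both of whose components are Lie algebra homomorphisms. Modules. A left module over $L$ is a $C_p$-Mackey functor $M$ such that $M(H)$ is a left module over the Lie algebra $L(H)$ for $H=e,C_p$, with $r(a\cdot m)=r(a)\cdot r(m)$, $c_g(x\cdot u)=c_g(x)\cdot c_g(u)$, $t(x)\cdot m=t(x\cdot r(m))$ and $a\cdot t(u)=t(r(a)\cdot u)$ for all $a\in L(C_p)$, $m\in M(C_p)$, $x\in L(e)$, $u\in M(e)$, $g\in C_p$. Right modules are defined similarly, and a bimodule is both a left and a right module; only the left action enters the definitions below. Cohomology. $C^0_{C_p}(L,M)=M(C_p)$. For $n\ge 1$, $C^n_{C_p}(L,M)$ is the $R$-module of pairs $(f_{C_p},f_e)$ of alternating $n$-linear maps $f_{C_p}:L(C_p)^n\to M(C_p)$, $f_e:L(e)^n\to M(e)$ that commute with restriction, $r_M f_{C_p}(a_1,\dots,a_n)=f_e(r_La_1,\dots,r_La_n)$, and conjugation, $c_g f_e(x_1,\dots,x_n)=f_e(c_gx_1,\dots,c_gx_n)$, and satisfy the Frobenius relation $f_{C_p}(t_L(x),a_2,\dots,a_n)=t_M(f_e(x,r_La_2,\dots,r_La_n))$ (and likewise in every other argument). For $n=1$ this is the module of Mackey functor morphisms $L\to M$. The coboundary is $b_0'(m)=(a\mapsto a\cdot m,\ x\mapsto x\cdot r_M(m))$, and for $n\ge1$, $b_n'(f_{C_p},f_e)=(\delta f_{C_p},\delta f_e)$ where $\delta$ is the usual Chevalley–Eilenberg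 coboundary $$\delta f(x_1,\dots,x_{n+1})=\sum_{i}(-1)^{i+1}x_i f(\dots,\widehat{x_i},\dots)+\sum_{i<j}(-1)^{i+j}f([x_i,x_j],\dots,\widehat{x_i},\dots,\widehat{x_j},\dots).$$ $H^2_{\mathrm{Green}_{\mathrm{Lie}}(C_p)}(L,M)=\ker(b_2')/\mathrm{im}(b_1')$ is the second cohomology of this complex. Extensions. A singular extension of $L$ by $M$ is an exact sequence of Mackey functors $0\to M\xrightarrow{i}B\xrightarrow{j}L\to0$ in which $B$ is a $C_p$-Green functor of Lie type, $j$ is a morphism of $C_p$-Green functors of Lie type, $i$ is a morphism of Mackey functors, and for $H=e,C_p$ the sequence $0\to M(H)\xrightarrow{i_H}B(H)\xrightarrow{j_H}L(H)\to0$ is a singular extension of the Lie algebra $L(H)$ by $M(H)$, that is, an extension whose kernel $i_H(M(H))$ is abelian: $[i_H(u),i_H(v)]=0$ for all $u,v\in M(H)$. The extension is $M$-split if there are Lie algebra homomorphisms $s_{C_p}:L(C_p)\to B(C_p)$, $s_e:L(e)\to B(e)$ with $j_{C_p}s_{C_p}=\mathrm{id}$, $j_es_e=\mathrm{id}$, $r_Bs_{C_p}=s_er_L$, $t_Bs_e=s_{C_p}t_L$ and $c_g s_e=s_e c_g$ for all $g\in C_p$. Two extensions $0\to M\xrightarrow{i}B\xrightarrow{j}L\to0$ and $0\to M\xrightarrow{i'}B'\xrightarrow{j'}L\to0$ are equivalent if there is a natural isomorphism $\beta:B\to B'$, i.e. a pair $(\beta_{C_p},\beta_e)$ of Lie algebra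 homomorphisms, commuting with the restriction and transfer maps and satisfying $\beta i=i'$ and $j'\beta=j$. $\mathrm{Ext}(L,M)$ is the set of equivalence classes of $M$-split singular extensions of $L$ by $M$.
   Formalization: M-split here asks only for linear sections commuting with restriction, transfer and conjugation, not Lie homomorphisms (the claim is then false); the bracket of B must induce the given left L-action on M; equivalences also commute with conjugation. *)

theory Defs
  imports "HOL-Algebra.Module" "HOL-Algebra.Elementary_Groups" "HOL-Library.Equipollence"
    "HOL-Computational_Algebra.Primes"
begin

section \<open>Linear maps, Lie algebras and their modules\<close>

definition char_zero :: "('r, 'x) ring_scheme \<Rightarrow> bool" where
  "char_zero R \<longleftrightarrow> (\<forall>n::nat. 0 < n \<longrightarrow> [n] \<cdot>\<^bsub>R\<^esub> \<one>\<^bsub>R\<^esub> \<noteq> \<zero>\<^bsub>R\<^esub>)"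

definition lin_maps ::
  "('r, 'x) ring_scheme \<Rightarrow> ('r, 'a, 'y) module_scheme \<Rightarrow> ('r, 'b, 'z) module_scheme \<Rightarrow> ('a \<Rightarrow> 'b) set" where
  "lin_maps R V W = {f \<in> carrier V \<rightarrow> carrier W.
     (\<forall>x\<in>carrier V. \<forall>y\<in>carrier V. f (x \<oplus>\<^bsub>V\<^esub> y) = f x \<oplus>\<^bsub>W\<^esub> f y) \<and>
     (\<forall>k\<in>carrier R. \<forall>x\<in>carrier V. f (k \<odot>\<^bsub>V\<^esub> x) = k \<odot>\<^bsub>W\<^esub> f x)}"

definition bilin_maps ::
  "('r, 'x) ring_scheme \<Rightarrow> ('r, 'a, 'y) module_scheme \<Rightarrow> ('r, 'b, 'z) module_scheme \<Rightarrow>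
   ('r, 'c, 'w) module_scheme \<Rightarrow> ('a \<Rightarrow> 'b \<Rightarrow> 'c) set" where
  "bilin_maps R U V W = {f. (\<forall>x\<in>carrier U. f x \<in> lin_maps R V W) \<and>
     (\<forall>y\<in>carrier V. (\<lambda>x. f x y) \<in> lin_maps R U W)}"

locale lie_algebra =
  fixes R :: "('r, 'x) ring_scheme"
    and V :: "('r, 'a, 'y) module_scheme"
    and br :: "'a \<Rightarrow> 'a \<Rightarrow> 'a"
  assumes is_module: "module R V"
    and bilinear: "br \<in> bilin_maps R V V V"
    and alternating: "x \<in> carrier V \<Longrightarrow> br x x = \<zero>\<^bsub>V\<^esub>"
    and jacobi: "\<lbrakk>x \<in> carrier V; y \<in> carrier V; z \<in> carrier V\<rbrakk> \<Longrightarrow>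
      br x (br y z) \<oplus>\<^bsub>V\<^esub> br y (br z x) \<oplus>\<^bsub>V\<^esub> br z (br x y) = \<zero>\<^bsub>V\<^esub>"

definition lie_homs ::
  "('r, 'x) ring_scheme \<Rightarrow> ('r, 'a, 'y) module_scheme \<Rightarrow> ('a \<Rightarrow> 'a \<Rightarrow> 'a) \<Rightarrow>
   ('r, 'b, 'z) module_scheme \<Rightarrow> ('b \<Rightarrow> 'b \<Rightarrow> 'b) \<Rightarrow> ('a \<Rightarrow> 'b) set" where
  "lie_homs R V br W br' = {f \<in> lin_maps R V W.
     \<forall>x\<in>carrier V. \<forall>y\<in>carrier V. f (br x y) = br' (f x) (f y)}"

locale lie_left_module =
  fixes R :: "('r, 'x) ring_scheme"
    and V :: "('r, 'a, 'y) module_scheme"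
    and br :: "'a \<Rightarrow> 'a \<Rightarrow> 'a"
    and W :: "('r, 'm, 'z) module_scheme"
    and act :: "'a \<Rightarrow> 'm \<Rightarrow> 'm"
  assumes is_module: "module R W"
    and bilinear: "act \<in> bilin_maps R V W W"
    and bracket_act: "\<lbrakk>x \<in> carrier V; y \<in> carrier V; m \<in> carrier W\<rbrakk> \<Longrightarrow>
      act (br x y) m = act x (act y m) \<ominus>\<^bsub>W\<^esub> act y (act x m)"

locale lie_right_module =
  fixes R :: "('r, 'x) ring_scheme"
    and V :: "('r, 'a, 'y) module_scheme"
    and br :: "'a \<Rightarrow> 'a \<Rightarrow> 'a"
    and W :: "('r, 'm, 'z) module_scheme"
    and act :: "'m \<Rightarrow> 'a \<Rightarrow> 'm"
  assumes is_module: "module R W"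
    and bilinear: "act \<in> bilin_maps R W V W"
    and act_bracket: "\<lbrakk>x \<in> carrier V; y \<in> carrier V; m \<in> carrier W\<rbrakk> \<Longrightarrow>
      act m (br x y) = act (act m x) y \<ominus>\<^bsub>W\<^esub> act (act m y) x"


section \<open>Mackey functors, Green functors of Lie type, bimodules\<close>

text \<open>
  The suffix \<open>C\<close> marks the level $C_p$ and the suffix \<open>E\<close> the level $e$. The group $C_p$ is
  \<^term>\<open>integer_mod_group p\<close>, whose elements are the integers $0, \dots, p-1$.
\<close>

record ('r, 'a, 'b) mackey =
  modC :: "('r, 'a) module"
  modE :: "('r, 'b) module"
  res :: "'a \<Rightarrow> 'b"
  tr :: "'b \<Rightarrow> 'a"
  cj :: "int \<Rightarrow> 'b \<Rightarrow> 'b"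

locale mackey_functor =
  fixes R :: "('r, 'x) ring_scheme" and p :: nat and M :: "('r, 'a, 'b, 'y) mackey_scheme"
  assumes module_C: "module R (modC M)"
    and module_E: "module R (modE M)"
    and res_lin: "res M \<in> lin_maps R (modC M) (modE M)"
    and tr_lin: "tr M \<in> lin_maps R (modE M) (modC M)"
    and cj_lin: "g \<in> carrier (integer_mod_group p) \<Longrightarrow> cj M g \<in> lin_maps R (modE M) (modE M)"
    and cj_one: "u \<in> carrier (modE M) \<Longrightarrow> cj M \<one>\<^bsub>integer_mod_group p\<^esub> u = u"
    and cj_mult: "\<lbrakk>g \<in> carrier (integer_mod_group p); h \<in> carrier (integer_mod_group p);
        u \<in> carrier (modE M)\<rbrakk> \<Longrightarrow>
      cj M (g \<otimes>\<^bsub>integer_mod_group p\<^esub> h) u = cj M g (cj M h u)"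
    and cj_res: "\<lbrakk>g \<in> carrier (integer_mod_group p); m \<in> carrier (modC M)\<rbrakk> \<Longrightarrow>
      cj M g (res M m) = res M m"
    and tr_cj: "\<lbrakk>g \<in> carrier (integer_mod_group p); u \<in> carrier (modE M)\<rbrakk> \<Longrightarrow>
      tr M (cj M g u) = tr M u"
    and res_tr: "u \<in> carrier (modE M) \<Longrightarrow>
      res M (tr M u) = (\<Oplus>\<^bsub>modE M\<^esub>g\<in>carrier (integer_mod_group p). cj M g u)"

definition mackey_morphism ::
  "('r, 'x) ring_scheme \<Rightarrow> nat \<Rightarrow> ('r, 'a, 'b, 'y) mackey_scheme \<Rightarrow> ('r, 'c, 'd, 'z) mackey_scheme \<Rightarrow>
   ('a \<Rightarrow> 'c) \<Rightarrow> ('b \<Rightarrow> 'd) \<Rightarrow> bool" where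
  "mackey_morphism R p M N fC fE \<longleftrightarrow>
     fC \<in> lin_maps R (modC M) (modC N) \<and>
     fE \<in> lin_maps R (modE M) (modE N) \<and>
     (\<forall>m\<in>carrier (modC M). res N (fC m) = fE (res M m)) \<and>
     (\<forall>u\<in>carrier (modE M). tr N (fE u) = fC (tr M u)) \<and>
     (\<forall>g\<in>carrier (integer_mod_group p). \<forall>u\<in>carrier (modE M). cj N g (fE u) = fE (cj M g u))"

record ('r, 'a, 'b) green_lie = "('r, 'a, 'b) mackey" +
  brC :: "'a \<Rightarrow> 'a \<Rightarrow> 'a"
  brE :: "'b \<Rightarrow> 'b \<Rightarrow> 'b"

locale green_lie_functor =
  mackey_functor R p L
  for R :: "('r, 'x) ring_scheme" and p :: nat and L :: "('r, 'a, 'b, 'y) green_lie_scheme" +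
  assumes lie_C: "lie_algebra R (modC L) (brC L)"
    and lie_E: "lie_algebra R (modE L) (brE L)"
    and res_lie: "res L \<in> lie_homs R (modC L) (brC L) (modE L) (brE L)"
    and cj_lie: "g \<in> carrier (integer_mod_group p) \<Longrightarrow>
      cj L g \<in> lie_homs R (modE L) (brE L) (modE L) (brE L)"
    and frobenius_left: "\<lbrakk>a \<in> carrier (modE L); b \<in> carrier (modC L)\<rbrakk> \<Longrightarrow>
      brC L (tr L a) b = tr L (brE L a (res L b))"
    and frobenius_right: "\<lbrakk>a \<in> carrier (modE L); b \<in> carrier (modC L)\<rbrakk> \<Longrightarrow>
      brC L b (tr L a) = tr L (brE L (res L b) a)"

definition green_lie_morphism ::
  "('r, 'x) ring_scheme \<Rightarrow> nat \<Rightarrow> ('r, 'a, 'b, 'y) green_lie_scheme \<Rightarrow> ('r, 'c, 'd, 'z) green_lie_scheme \<Rightarrow>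
   ('a \<Rightarrow> 'c) \<Rightarrow> ('b \<Rightarrow> 'd) \<Rightarrow> bool" where
  "green_lie_morphism R p L N fC fE \<longleftrightarrow>
     mackey_morphism R p L N fC fE \<and>
     fC \<in> lie_homs R (modC L) (brC L) (modC N) (brC N) \<and>
     fE \<in> lie_homs R (modE L) (brE L) (modE N) (brE N)"

record ('r, 'la, 'lb, 'a, 'b) green_bimod = "('r, 'a, 'b) mackey" +
  lactC :: "'la \<Rightarrow> 'a \<Rightarrow> 'a"
  lactE :: "'lb \<Rightarrow> 'b \<Rightarrow> 'b"
  ractC :: "'a \<Rightarrow> 'la \<Rightarrow> 'a"
  ractE :: "'b \<Rightarrow> 'lb \<Rightarrow> 'b"

locale green_left_module =
  mackey_functor R p M
  for R :: "('r, 'x) ring_scheme" and p :: nat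
    and L :: "('r, 'la, 'lb, 'y) green_lie_scheme"
    and M :: "('r, 'la, 'lb, 'a, 'b, 'z) green_bimod_scheme" +
  assumes left_C: "lie_left_module R (modC L) (brC L) (modC M) (lactC M)"
    and left_E: "lie_left_module R (modE L) (brE L) (modE M) (lactE M)"
    and res_lact: "\<lbrakk>a \<in> carrier (modC L); m \<in> carrier (modC M)\<rbrakk> \<Longrightarrow>
      res M (lactC M a m) = lactE M (res L a) (res M m)"
    and cj_lact: "\<lbrakk>g \<in> carrier (integer_mod_group p); x \<in> carrier (modE L); u \<in> carrier (modE M)\<rbrakk> \<Longrightarrow>
      cj M g (lactE M x u) = lactE M (cj L g x) (cj M g u)"
    and tr_lact: "\<lbrakk>x \<in> carrier (modE L); m \<in> carrier (modC M)\<rbrakk> \<Longrightarrow>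
      lactC M (tr L x) m = tr M (lactE M x (res M m))"
    and lact_tr: "\<lbrakk>a \<in> carrier (modC L); u \<in> carrier (modE M)\<rbrakk> \<Longrightarrow>
      lactC M a (tr M u) = tr M (lactE M (res L a) u)"

locale green_right_module =
  mackey_functor R p M
  for R :: "('r, 'x) ring_scheme" and p :: nat
    and L :: "('r, 'la, 'lb, 'y) green_lie_scheme"
    and M :: "('r, 'la, 'lb, 'a, 'b, 'z) green_bimod_scheme" +
  assumes right_C: "lie_right_module R (modC L) (brC L) (modC M) (ractC M)"
    and right_E: "lie_right_module R (modE L) (brE L) (modE M) (ractE M)"
    and res_ract: "\<lbrakk>a \<in> carrier (modC L); m \<in> carrier (modC M)\<rbrakk> \<Longrightarrow>
      res M (ractC M m a) = ractE M (res M m) (res L a)"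
    and cj_ract: "\<lbrakk>g \<in> carrier (integer_mod_group p); x \<in> carrier (modE L); u \<in> carrier (modE M)\<rbrakk> \<Longrightarrow>
      cj M g (ractE M u x) = ractE M (cj M g u) (cj L g x)"
    and ract_tr: "\<lbrakk>x \<in> carrier (modE L); m \<in> carrier (modC M)\<rbrakk> \<Longrightarrow>
      ractC M m (tr L x) = tr M (ractE M (res M m) x)"
    and tr_ract: "\<lbrakk>a \<in> carrier (modC L); u \<in> carrier (modE M)\<rbrakk> \<Longrightarrow>
      ractC M (tr M u) a = tr M (ractE M u (res L a))"

locale green_bimodule =
  green_left_module R p L M + green_right_module R p L M
  for R :: "('r, 'x) ring_scheme" and p :: nat
    and L :: "('r, 'la, 'lb, 'y) green_lie_scheme"
    and M :: "('r, 'la, 'lb, 'a, 'b, 'z) green_bimod_scheme"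


section \<open>The Chevalley--Eilenberg complex\<close>

definition tuples :: "('a, 'x) partial_object_scheme \<Rightarrow> nat \<Rightarrow> 'a list set" where
  "tuples V n = {xs. length xs = n \<and> set xs \<subseteq> carrier V}"

definition del_nth :: "nat \<Rightarrow> 'a list \<Rightarrow> 'a list" where
  "del_nth i xs = take i xs @ drop (Suc i) xs"

definition alt_sign :: "('a, 'x) ring_scheme \<Rightarrow> nat \<Rightarrow> 'a \<Rightarrow> 'a" where
  "alt_sign W k m = (if even k then m else \<ominus>\<^bsub>W\<^esub> m)"

text \<open>An \<open>n\<close>-linear map is a function of lists of length \<open>n\<close>; extensionality makes equality
  of cochains coincide with equality on the carrier.\<close>

definition alt_maps ::
  "('r, 'x) ring_scheme \<Rightarrow> ('r, 'a, 'y) module_scheme \<Rightarrow> ('r, 'b, 'z) module_scheme \<Rightarrow> nat \<Rightarrow>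
   ('a list \<Rightarrow> 'b) set" where
  "alt_maps R V W n = {f \<in> tuples V n \<rightarrow>\<^sub>E carrier W.
     (\<forall>xs\<in>tuples V n. \<forall>i<n. (\<lambda>x. f (xs[i := x])) \<in> lin_maps R V W) \<and>
     (\<forall>xs\<in>tuples V n. \<forall>i<n. \<forall>j<n. i \<noteq> j \<and> xs ! i = xs ! j \<longrightarrow> f xs = \<zero>\<^bsub>W\<^esub>)}"

text \<open>List positions start at $0$, which accounts for the sign of the summand \<open>i\<close> in the first sum.\<close>

definition ce_delta ::
  "('r, 'a, 'y) module_scheme \<Rightarrow> ('a \<Rightarrow> 'a \<Rightarrow> 'a) \<Rightarrow> ('r, 'b, 'z) module_scheme \<Rightarrow> ('a \<Rightarrow> 'b \<Rightarrow> 'b) \<Rightarrow>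
   nat \<Rightarrow> ('a list \<Rightarrow> 'b) \<Rightarrow> 'a list \<Rightarrow> 'b" where
  "ce_delta V br W act n f = (\<lambda>xs\<in>tuples V (Suc n).
     (\<Oplus>\<^bsub>W\<^esub>i\<in>{..n}. alt_sign W i (act (xs ! i) (f (del_nth i xs)))) \<oplus>\<^bsub>W\<^esub>
     (\<Oplus>\<^bsub>W\<^esub>ij\<in>{(i, j). i < j \<and> j \<le> n}.
        alt_sign W (fst ij + snd ij)
          (f (br (xs ! fst ij) (xs ! snd ij) # del_nth (fst ij) (del_nth (snd ij) xs)))))"

definition cochains ::
  "('r, 'x) ring_scheme \<Rightarrow> nat \<Rightarrow> ('r, 'la, 'lb, 'y) green_lie_scheme \<Rightarrow>
   ('r, 'la, 'lb, 'a, 'b, 'z) green_bimod_scheme \<Rightarrow> nat \<Rightarrow>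
   (('la list \<Rightarrow> 'a) \<times> ('lb list \<Rightarrow> 'b)) set" where
  "cochains R p L M n = {(fC, fE).
     fC \<in> alt_maps R (modC L) (modC M) n \<and>
     fE \<in> alt_maps R (modE L) (modE M) n \<and>
     (\<forall>as\<in>tuples (modC L) n. res M (fC as) = fE (map (res L) as)) \<and>
     (\<forall>g\<in>carrier (integer_mod_group p). \<forall>xs\<in>tuples (modE L) n.
        cj M g (fE xs) = fE (map (cj L g) xs)) \<and>
     (\<forall>as\<in>tuples (modC L) n. \<forall>i<n. \<forall>x\<in>carrier (modE L).
        fC (as[i := tr L x]) = tr M (fE ((map (res L) as)[i := x])))}"

text \<open>The additive group of $C^n$; it is used only for \<open>n \<ge> 1\<close>.\<close>

definition cochain_group ::
  "('r, 'x) ring_scheme \<Rightarrow> nat \<Rightarrow> ('r, 'la, 'lb, 'y) green_lie_scheme \<Rightarrow>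
   ('r, 'la, 'lb, 'a, 'b, 'z) green_bimod_scheme \<Rightarrow> nat \<Rightarrow>
   (('la list \<Rightarrow> 'a) \<times> ('lb list \<Rightarrow> 'b)) monoid" where
  "cochain_group R p L M n =
     \<lparr>carrier = cochains R p L M n,
      monoid.mult = (\<lambda>(fC, fE) (hC, hE).
        (\<lambda>as\<in>tuples (modC L) n. fC as \<oplus>\<^bsub>modC M\<^esub> hC as,
         \<lambda>xs\<in>tuples (modE L) n. fE xs \<oplus>\<^bsub>modE M\<^esub> hE xs)),
      one = (\<lambda>as\<in>tuples (modC L) n. \<zero>\<^bsub>modC M\<^esub>, \<lambda>xs\<in>tuples (modE L) n. \<zero>\<^bsub>modE M\<^esub>)\<rparr>"

definition coboundary ::
  "('r, 'la, 'lb, 'y) green_lie_scheme \<Rightarrow> ('r, 'la, 'lb, 'a, 'b, 'z) green_bimod_scheme \<Rightarrow> nat \<Rightarrow>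
   ('la list \<Rightarrow> 'a) \<times> ('lb list \<Rightarrow> 'b) \<Rightarrow> ('la list \<Rightarrow> 'a) \<times> ('lb list \<Rightarrow> 'b)" where
  "coboundary L M n = (\<lambda>(fC, fE).
     (ce_delta (modC L) (brC L) (modC M) (lactC M) n fC,
      ce_delta (modE L) (brE L) (modE M) (lactE M) n fE))"

definition H2_Green_Lie ::
  "('r, 'x) ring_scheme \<Rightarrow> nat \<Rightarrow> ('r, 'la, 'lb, 'y) green_lie_scheme \<Rightarrow>
   ('r, 'la, 'lb, 'a, 'b, 'z) green_bimod_scheme \<Rightarrow>
   (('la list \<Rightarrow> 'a) \<times> ('lb list \<Rightarrow> 'b)) set monoid" where
  "H2_Green_Lie R p L M =
     (cochain_group R p L M 2)
       \<lparr>carrier := kernel (cochain_group R p L M 2) (cochain_group R p L M 3) (coboundary L M 2)\<rparr>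
     Mod (coboundary L M 1 ` carrier (cochain_group R p L M 1))"


section \<open>Singular extensions\<close>

record ('r, 'la, 'lb, 'ma, 'mb, 'ba, 'bb) extension =
  mid :: "('r, 'ba, 'bb) green_lie"
  incC :: "'ma \<Rightarrow> 'ba"
  incE :: "'mb \<Rightarrow> 'bb"
  projC :: "'ba \<Rightarrow> 'la"
  projE :: "'bb \<Rightarrow> 'lb"

definition short_exact ::
  "('r, 'm, 'x) module_scheme \<Rightarrow> ('m \<Rightarrow> 'b) \<Rightarrow> ('r, 'b, 'y) module_scheme \<Rightarrow> ('b \<Rightarrow> 'l) \<Rightarrow>
   ('r, 'l, 'z) module_scheme \<Rightarrow> bool" where
  "short_exact W i V j U \<longleftrightarrow>
     inj_on i (carrier W) \<and>
     i ` carrier W = {b \<in> carrier V. j b = \<zero>\<^bsub>U\<^esub>} \<and>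
     j ` carrier V = carrier U"

text \<open>
  The two conditions on \<open>incC\<close> and \<open>incE\<close> of the form \<open>[b, i u] = i (j b \<cdot> u)\<close> express that this
  is an extension of \<open>L\<close> by the \<^emph>\<open>module\<close> \<open>M\<close>: the action of \<open>L\<close> on the abelian kernel that the
  bracket of the middle term induces is the given left action.
\<close>

definition singular_extension ::
  "('r, 'x) ring_scheme \<Rightarrow> nat \<Rightarrow> ('r, 'la, 'lb, 'y) green_lie_scheme \<Rightarrow>
   ('r, 'la, 'lb, 'ma, 'mb, 'z) green_bimod_scheme \<Rightarrow>
   ('r, 'la, 'lb, 'ma, 'mb, 'ba, 'bb) extension \<Rightarrow> bool" where
  "singular_extension R p L M X \<longleftrightarrow>
     green_lie_functor R p (mid X) \<and>
     mackey_morphism R p M (mid X) (incC X) (incE X) \<and>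
     green_lie_morphism R p (mid X) L (projC X) (projE X) \<and>
     short_exact (modC M) (incC X) (modC (mid X)) (projC X) (modC L) \<and>
     short_exact (modE M) (incE X) (modE (mid X)) (projE X) (modE L) \<and>
     (\<forall>u\<in>carrier (modC M). \<forall>v\<in>carrier (modC M).
        brC (mid X) (incC X u) (incC X v) = \<zero>\<^bsub>modC (mid X)\<^esub>) \<and>
     (\<forall>u\<in>carrier (modE M). \<forall>v\<in>carrier (modE M).
        brE (mid X) (incE X u) (incE X v) = \<zero>\<^bsub>modE (mid X)\<^esub>) \<and>
     (\<forall>b\<in>carrier (modC (mid X)). \<forall>u\<in>carrier (modC M).
        brC (mid X) b (incC X u) = incC X (lactC M (projC X b) u)) \<and>
     (\<forall>b\<in>carrier (modE (mid X)). \<forall>u\<in>carrier (modE M).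
        brE (mid X) b (incE X u) = incE X (lactE M (projE X b) u))"

text \<open>
  Split in the category of Mackey functors: the section is linear and compatible with restriction,
  transfer and conjugation. It is \<^emph>\<open>not\<close> required to preserve brackets. A section by Lie algebra
  homomorphisms would identify the extension with the semidirect product, so there would be exactly
  one equivalence class; the class in $H^2$ is the obstruction
  $[s(x), s(y)] - s[x, y]$ to a section being such a homomorphism.
\<close>

definition M_split ::
  "('r, 'x) ring_scheme \<Rightarrow> nat \<Rightarrow> ('r, 'la, 'lb, 'y) green_lie_scheme \<Rightarrow>
   ('r, 'la, 'lb, 'ma, 'mb, 'ba, 'bb) extension \<Rightarrow> bool" where
  "M_split R p L X \<longleftrightarrow> (\<exists>sC sE. mackey_morphism R p L (mid X) sC sE \<and>
     (\<forall>a\<in>carrier (modC L). projC X (sC a) = a) \<and>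
     (\<forall>x\<in>carrier (modE L). projE X (sE x) = x))"

definition ext_equivalent ::
  "('r, 'x) ring_scheme \<Rightarrow> nat \<Rightarrow> ('r, 'ma, 'mb, 'z) mackey_scheme \<Rightarrow>
   ('r, 'la, 'lb, 'ma, 'mb, 'ba, 'bb) extension \<Rightarrow>
   ('r, 'la, 'lb, 'ma, 'mb, 'ba, 'bb) extension \<Rightarrow> bool" where
  "ext_equivalent R p M X Y \<longleftrightarrow> (\<exists>\<beta>C \<beta>E.
     green_lie_morphism R p (mid X) (mid Y) \<beta>C \<beta>E \<and>
     bij_betw \<beta>C (carrier (modC (mid X))) (carrier (modC (mid Y))) \<and>
     bij_betw \<beta>E (carrier (modE (mid X))) (carrier (modE (mid Y))) \<and>
     (\<forall>u\<in>carrier (modC M). \<beta>C (incC X u) = incC Y u) \<and>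
     (\<forall>u\<in>carrier (modE M). \<beta>E (incE X u) = incE Y u) \<and>
     (\<forall>b\<in>carrier (modC (mid X)). projC Y (\<beta>C b) = projC X b) \<and>
     (\<forall>b\<in>carrier (modE (mid X)). projE Y (\<beta>E b) = projE X b))"

text \<open>
  The middle terms live in a universe given by the types \<open>'ba\<close> and \<open>'bb\<close>. As a set the middle term
  of an extension is in bijection with \<open>M \<times> L\<close> at each level, so every extension is isomorphic to
  one in this universe as soon as \<open>M \<times> L\<close> embeds into the two types levelwise.
\<close>

definition Ext ::
  "('r, 'x) ring_scheme \<Rightarrow> nat \<Rightarrow> ('r, 'la, 'lb, 'y) green_lie_scheme \<Rightarrow>
   ('r, 'la, 'lb, 'ma, 'mb, 'z) green_bimod_scheme \<Rightarrow>
   ('r, 'la, 'lb, 'ma, 'mb, 'ba, 'bb) extension set set" where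
  "Ext R p L M =
     {X. singular_extension R p L M X \<and> M_split R p L X} //
     {(X, Y). singular_extension R p L M X \<and> M_split R p L X \<and>
        singular_extension R p L M Y \<and> M_split R p L Y \<and> ext_equivalent R p M X Y}"

end

theory Submission
  imports Defs
begin

text \<open>
  A Mackey section \<open>s\<close> of an extension determines a factor set \<open>[s a, s b] - s [a, b]\<close> at each level,
  and the factor sets of one extension, over all sections, form exactly one coset of the
  coboundaries: sections differ by a Mackey morphism \<open>h: L \<rightarrow> M\<close>, which changes the factor set by the
  coboundary of \<open>h\<close>. Two extensions with a common factor set are equivalent through
  \<open>i m + s a \<mapsto> i' m + s' a\<close>, and the twisted product \<open>M \<times> L\<close> realises any cocycle. So sending an
  extension to its set of factor sets is the required bijection, and the group structure of the
  second cohomology plays no role.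
\<close>

section \<open>Linear maps\<close>

text \<open>A Mackey section is chosen at both levels at once, compatibly with restriction, transfer
  and conjugation. The Lie-theoretic arguments can therefore be carried out for a single Lie algebra
  and instantiated twice; what remains is whether the resulting maps respect the Mackey structure.
  For factor sets this is tested after applying the injective inclusion of the kernel, where the
  Frobenius rules of \<open>L\<close> and of the middle term are both available.

  Equivalence of extensions is turned into equality of sets. Elements of the quotient defining the
  cohomology group are cosets, that is, sets of cochains, and an extension is sent to a set of
  cochains of the same kind. So no section is singled out, no independence of a choice has to be
  shown, and the relation on extensions becomes the kernel of a map.

  Extensions are records over fixed types, so the product of \<open>M\<close> and \<open>L\<close>
  has to be moved into the types of the middle terms by injections; these are what the two universe
  hypotheses supply.\<close>

lemma lin_mapsI:
  assumes "\<And>x. x \<in> carrier V \<Longrightarrow> f x \<in> carrier W"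
    and "\<And>x y. \<lbrakk>x \<in> carrier V; y \<in> carrier V\<rbrakk> \<Longrightarrow> f (x \<oplus>\<^bsub>V\<^esub> y) = f x \<oplus>\<^bsub>W\<^esub> f y"
    and "\<And>k x. \<lbrakk>k \<in> carrier R; x \<in> carrier V\<rbrakk> \<Longrightarrow> f (k \<odot>\<^bsub>V\<^esub> x) = k \<odot>\<^bsub>W\<^esub> f x"
  shows "f \<in> lin_maps R V W"
  using assms by (auto simp: lin_maps_def)

lemma
  assumes "f \<in> lin_maps R V W"
  shows lin_maps_closed: "x \<in> carrier V \<Longrightarrow> f x \<in> carrier W"
    and lin_maps_add: "\<lbrakk>x \<in> carrier V; y \<in> carrier V\<rbrakk> \<Longrightarrow> f (x \<oplus>\<^bsub>V\<^esub> y) = f x \<oplus>\<^bsub>W\<^esub> f y"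
    and lin_maps_smult: "\<lbrakk>k \<in> carrier R; x \<in> carrier V\<rbrakk> \<Longrightarrow> f (k \<odot>\<^bsub>V\<^esub> x) = k \<odot>\<^bsub>W\<^esub> f x"
  using assms by (auto simp: lin_maps_def)

lemma lin_maps_cong:
  assumes "module R V" "\<And>x. x \<in> carrier V \<Longrightarrow> f x = g x"
  shows "f \<in> lin_maps R V W \<longleftrightarrow> g \<in> lin_maps R V W"
proof -
  interpret V: module R V by fact
  show ?thesis using assms(2) by (auto simp: lin_maps_def Pi_def)
qed

context
  fixes R :: "('r, 'x) ring_scheme" and V :: "('r, 'a, 'y) module_scheme"
    and W :: "('r, 'b, 'z) module_scheme" and f
  assumes VW: "module R V" "module R W" and f: "f \<in> lin_maps R V W"
begin

interpretation V: module R V by (rule VW)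
interpretation W: module R W by (rule VW)

lemma lin_maps_zero: "f \<zero>\<^bsub>V\<^esub> = \<zero>\<^bsub>W\<^esub>"
proof -
  have "f \<zero>\<^bsub>V\<^esub> \<oplus>\<^bsub>W\<^esub> f \<zero>\<^bsub>V\<^esub> = f \<zero>\<^bsub>V\<^esub>"
    by (simp flip: lin_maps_add[OF f])
  then show ?thesis
    using lin_maps_closed[OF f] W.M.add.r_cancel_one by blast
qed

lemma lin_maps_neg: "x \<in> carrier V \<Longrightarrow> f (\<ominus>\<^bsub>V\<^esub> x) = \<ominus>\<^bsub>W\<^esub> f x"
  using lin_maps_add[OF f, of "\<ominus>\<^bsub>V\<^esub> x" x] lin_maps_closed[OF f]
  by (simp add: V.M.l_neg lin_maps_zero W.M.minus_equality)

lemma lin_maps_minus: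
  "\<lbrakk>x \<in> carrier V; y \<in> carrier V\<rbrakk> \<Longrightarrow> f (x \<ominus>\<^bsub>V\<^esub> y) = f x \<ominus>\<^bsub>W\<^esub> f y"
  by (simp add: V.M.minus_eq W.M.minus_eq lin_maps_add[OF f] lin_maps_neg)

end

lemma lin_maps_comp:
  assumes "f \<in> lin_maps R U V" "g \<in> lin_maps R V W"
  shows "(\<lambda>x. g (f x)) \<in> lin_maps R U W"
  using assms by (auto simp: lin_maps_def Pi_def)

lemma lin_maps_pointwise_add:
  assumes "module R W" and f: "f \<in> lin_maps R V W" and g: "g \<in> lin_maps R V W"
  shows "(\<lambda>x. f x \<oplus>\<^bsub>W\<^esub> g x) \<in> lin_maps R V W"
proof -
  interpret W: module R W by fact
  show ?thesis
    by (rule lin_mapsI)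
      (simp_all add: lin_maps_closed[OF f] lin_maps_closed[OF g] lin_maps_add[OF f]
        lin_maps_add[OF g] lin_maps_smult[OF f] lin_maps_smult[OF g] W.smult_r_distr W.M.a_ac)
qed

lemma lin_maps_pointwise_minus:
  assumes "module R W" and f: "f \<in> lin_maps R V W" and g: "g \<in> lin_maps R V W"
  shows "(\<lambda>x. f x \<ominus>\<^bsub>W\<^esub> g x) \<in> lin_maps R V W"
proof -
  interpret W: module R W by fact
  show ?thesis
    by (rule lin_mapsI)
      (simp_all add: lin_maps_closed[OF f] lin_maps_closed[OF g] lin_maps_add[OF f]
        lin_maps_add[OF g] lin_maps_smult[OF f] lin_maps_smult[OF g] W.smult_r_distr W.M.a_ac
        W.M.minus_eq W.M.minus_add W.smult_r_minus)
qed

text \<open>An injective linear map reflects linearity: each identity for \<open>h\<close> becomes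
  one for \<open>f\<close> once \<open>i\<close> is applied to it. This serves the retraction onto
  the kernel, which is defined only by inverting \<open>i\<close>.\<close>

lemma lin_maps_factor:
  assumes "module R V" "module R W" "i \<in> lin_maps R V W" "inj_on i (carrier V)"
    and "f \<in> lin_maps R U W" "module R U"
    and h: "\<And>x. x \<in> carrier U \<Longrightarrow> h x \<in> carrier V" "\<And>x. x \<in> carrier U \<Longrightarrow> i (h x) = f x"
  shows "h \<in> lin_maps R U V"
proof -
  interpret V: module R V by fact
  interpret U: module R U by fact
  show ?thesis
    by (rule lin_mapsI; (rule inj_onD[OF assms(4)])?)
      (simp_all add: h lin_maps_add[OF assms(3)] lin_maps_add[OF assms(5)]
        lin_maps_smult[OF assms(3)] lin_maps_smult[OF assms(5)])
qed

section \<open>Bilinear maps\<close>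

context
  fixes R :: "('r, 'x) ring_scheme" and U :: "('r, 'a, 'y) module_scheme"
    and V :: "('r, 'b, 'w) module_scheme" and W :: "('r, 'c, 'z) module_scheme" and f
  assumes f: "f \<in> bilin_maps R U V W"
begin

lemma bilin_maps_left: "y \<in> carrier V \<Longrightarrow> (\<lambda>x. f x y) \<in> lin_maps R U W"
  and bilin_maps_right: "x \<in> carrier U \<Longrightarrow> f x \<in> lin_maps R V W"
  using f by (auto simp: bilin_maps_def)

lemma bilin_maps_closed: "\<lbrakk>x \<in> carrier U; y \<in> carrier V\<rbrakk> \<Longrightarrow> f x y \<in> carrier W"
  by (rule lin_maps_closed[OF bilin_maps_right])

lemma bilin_maps_add_left:
  "\<lbrakk>x \<in> carrier U; x' \<in> carrier U; y \<in> carrier V\<rbrakk> \<Longrightarrow> f (x \<oplus>\<^bsub>U\<^esub> x') y = f x y \<oplus>\<^bsub>W\<^esub> f x' y"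
  by (rule lin_maps_add[OF bilin_maps_left])

lemma bilin_maps_add_right:
  "\<lbrakk>x \<in> carrier U; y \<in> carrier V; y' \<in> carrier V\<rbrakk> \<Longrightarrow> f x (y \<oplus>\<^bsub>V\<^esub> y') = f x y \<oplus>\<^bsub>W\<^esub> f x y'"
  by (rule lin_maps_add[OF bilin_maps_right])

lemma bilin_maps_smult_left:
  "\<lbrakk>k \<in> carrier R; x \<in> carrier U; y \<in> carrier V\<rbrakk> \<Longrightarrow> f (k \<odot>\<^bsub>U\<^esub> x) y = k \<odot>\<^bsub>W\<^esub> f x y"
  by (rule lin_maps_smult[OF bilin_maps_left])

lemma bilin_maps_smult_right:
  "\<lbrakk>k \<in> carrier R; x \<in> carrier U; y \<in> carrier V\<rbrakk> \<Longrightarrow> f x (k \<odot>\<^bsub>V\<^esub> y) = k \<odot>\<^bsub>W\<^esub> f x y"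
  by (rule lin_maps_smult[OF bilin_maps_right])

end

lemmas bilin_maps_simps = bilin_maps_closed bilin_maps_add_left bilin_maps_add_right
  bilin_maps_smult_left bilin_maps_smult_right

lemma bilin_mapsI:
  assumes "\<And>x y. \<lbrakk>x \<in> carrier U; y \<in> carrier V\<rbrakk> \<Longrightarrow> f x y \<in> carrier W"
    and "\<And>x x' y. \<lbrakk>x \<in> carrier U; x' \<in> carrier U; y \<in> carrier V\<rbrakk> \<Longrightarrow>
      f (x \<oplus>\<^bsub>U\<^esub> x') y = f x y \<oplus>\<^bsub>W\<^esub> f x' y"
    and "\<And>x y y'. \<lbrakk>x \<in> carrier U; y \<in> carrier V; y' \<in> carrier V\<rbrakk> \<Longrightarrow>
      f x (y \<oplus>\<^bsub>V\<^esub> y') = f x y \<oplus>\<^bsub>W\<^esub> f x y'"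
    and "\<And>k x y. \<lbrakk>k \<in> carrier R; x \<in> carrier U; y \<in> carrier V\<rbrakk> \<Longrightarrow>
      f (k \<odot>\<^bsub>U\<^esub> x) y = k \<odot>\<^bsub>W\<^esub> f x y"
    and "\<And>k x y. \<lbrakk>k \<in> carrier R; x \<in> carrier U; y \<in> carrier V\<rbrakk> \<Longrightarrow>
      f x (k \<odot>\<^bsub>V\<^esub> y) = k \<odot>\<^bsub>W\<^esub> f x y"
  shows "f \<in> bilin_maps R U V W"
  using assms by (auto simp: bilin_maps_def intro!: lin_mapsI)

section \<open>Morphisms of Mackey functors\<close>

lemma mackey_morphism_comp:
  assumes "mackey_morphism R p A B fC fE" "mackey_morphism R p B C gC gE"
  shows "mackey_morphism R p A C (\<lambda>x. gC (fC x)) (\<lambda>x. gE (fE x))"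
  using assms unfolding mackey_morphism_def
  by (auto intro: lin_maps_comp dest: lin_maps_closed)

lemma mackey_morphism_add:
  assumes "mackey_functor R p A" "mackey_functor R p B"
    and f: "mackey_morphism R p A B fC fE" and g: "mackey_morphism R p A B gC gE"
  shows "mackey_morphism R p A B (\<lambda>x. fC x \<oplus>\<^bsub>modC B\<^esub> gC x) (\<lambda>x. fE x \<oplus>\<^bsub>modE B\<^esub> gE x)"
proof -
  interpret A: mackey_functor R p A by fact
  interpret B: mackey_functor R p B by fact
  have fg: "fC \<in> lin_maps R (modC A) (modC B)" "gC \<in> lin_maps R (modC A) (modC B)"
    "fE \<in> lin_maps R (modE A) (modE B)" "gE \<in> lin_maps R (modE A) (modE B)"
    using f g by (auto simp: mackey_morphism_def)
  note closed = fg[THEN lin_maps_closed] lin_maps_closed[OF A.res_lin] lin_maps_closed[OF A.tr_lin]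
    lin_maps_closed[OF A.cj_lin]
  show ?thesis
    using f g unfolding mackey_morphism_def
    by (simp add: fg lin_maps_pointwise_add[OF B.module_C] lin_maps_pointwise_add[OF B.module_E]
        lin_maps_add[OF B.res_lin] lin_maps_add[OF B.tr_lin] lin_maps_add[OF B.cj_lin] closed)
qed

lemma mackey_morphism_minus:
  assumes "mackey_functor R p A" "mackey_functor R p B"
    and f: "mackey_morphism R p A B fC fE" and g: "mackey_morphism R p A B gC gE"
  shows "mackey_morphism R p A B (\<lambda>x. fC x \<ominus>\<^bsub>modC B\<^esub> gC x) (\<lambda>x. fE x \<ominus>\<^bsub>modE B\<^esub> gE x)"
proof -
  interpret A: mackey_functor R p A by fact
  interpret B: mackey_functor R p B by fact
  have fg: "fC \<in> lin_maps R (modC A) (modC B)" "gC \<in> lin_maps R (modC A) (modC B)"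
    "fE \<in> lin_maps R (modE A) (modE B)" "gE \<in> lin_maps R (modE A) (modE B)"
    using f g by (auto simp: mackey_morphism_def)
  note closed = fg[THEN lin_maps_closed] lin_maps_closed[OF A.res_lin] lin_maps_closed[OF A.tr_lin]
    lin_maps_closed[OF A.cj_lin]
  show ?thesis
    using f g unfolding mackey_morphism_def
    by (simp add: fg lin_maps_pointwise_minus[OF B.module_C] lin_maps_pointwise_minus[OF B.module_E]
        lin_maps_minus[OF B.module_C B.module_E B.res_lin]
        lin_maps_minus[OF B.module_E B.module_C B.tr_lin]
        lin_maps_minus[OF B.module_E B.module_E B.cj_lin] closed)
qed

lemma mackey_morphism_id: "mackey_morphism R p A A (\<lambda>x. x) (\<lambda>x. x)"
  by (auto simp: mackey_morphism_def lin_maps_def)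

text \<open>Every compatibility of \<open>hC\<close> and \<open>hE\<close> can be checked after the
  injective inclusions, which commute with the structure maps of \<open>M\<close> and
  \<open>B\<close>. The retraction of a split extension is recognised as a Mackey morphism in this
  way.\<close>

lemma mackey_morphism_factor:
  assumes A: "mackey_functor R p A" and M: "mackey_functor R p M" and B: "mackey_functor R p B"
    and i: "mackey_morphism R p M B iC iE"
    and inj: "inj_on iC (carrier (modC M))" "inj_on iE (carrier (modE M))"
    and f: "mackey_morphism R p A B fC fE"
    and hC: "\<And>x. x \<in> carrier (modC A) \<Longrightarrow> hC x \<in> carrier (modC M)"
      "\<And>x. x \<in> carrier (modC A) \<Longrightarrow> iC (hC x) = fC x"
    and hE: "\<And>x. x \<in> carrier (modE A) \<Longrightarrow> hE x \<in> carrier (modE M)"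
      "\<And>x. x \<in> carrier (modE A) \<Longrightarrow> iE (hE x) = fE x"
  shows "mackey_morphism R p A M hC hE"
proof -
  interpret A: mackey_functor R p A by fact
  interpret M: mackey_functor R p M by fact
  interpret B: mackey_functor R p B by fact
  note f = f[unfolded mackey_morphism_def] and i = i[unfolded mackey_morphism_def]
  note Acl = lin_maps_closed[OF A.res_lin] lin_maps_closed[OF A.tr_lin] lin_maps_closed[OF A.cj_lin]
  note Mcl = lin_maps_closed[OF M.res_lin] lin_maps_closed[OF M.tr_lin] lin_maps_closed[OF M.cj_lin]
  show ?thesis unfolding mackey_morphism_def
  proof (intro conjI ballI)
    show "hC \<in> lin_maps R (modC A) (modC M)" "hE \<in> lin_maps R (modE A) (modE M)"
      by (rule lin_maps_factor[OF M.module_C B.module_C _ inj(1) _ A.module_C hC]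
          lin_maps_factor[OF M.module_E B.module_E _ inj(2) _ A.module_E hE];
          use f i in simp)+
  next
    fix m assume m: "m \<in> carrier (modC A)"
    have "iE (res M (hC m)) = res B (iC (hC m))" using i hC(1) m by simp
    also have "\<dots> = iE (hE (res A m))" using f hC hE m Acl by simp
    finally show "res M (hC m) = hE (res A m)"
      by (rule inj_onD[OF inj(2)]) (simp_all add: Mcl Acl hC hE m)
  next
    fix u assume u: "u \<in> carrier (modE A)"
    have "iC (tr M (hE u)) = tr B (iE (hE u))" using i hE(1) u by simp
    also have "\<dots> = iC (hC (tr A u))" using f hC hE u Acl by simp
    finally show "tr M (hE u) = hC (tr A u)"
      by (rule inj_onD[OF inj(1)]) (simp_all add: Mcl Acl hC hE u)
  next
    fix g u assume g: "g \<in> carrier (integer_mod_group p)" and u: "u \<in> carrier (modE A)"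
    have "iE (cj M g (hE u)) = cj B g (iE (hE u))" using i hE(1) u g by simp
    also have "\<dots> = iE (hE (cj A g u))" using f hC hE u g Acl by simp
    finally show "cj M g (hE u) = hE (cj A g u)"
      by (rule inj_onD[OF inj(2)]) (simp_all add: Mcl Acl hC hE u g)
  qed
qed

section \<open>Lie algebra extensions and their factor sets\<close>

text \<open>Polarisation: expand \<open>F (x + y) (x + y) = 0\<close>.\<close>

lemma alternating_skew:
  assumes "module R V" "module R W" and F: "F \<in> bilin_maps R V V W"
    and alt: "\<And>x. x \<in> carrier V \<Longrightarrow> F x x = \<zero>\<^bsub>W\<^esub>"
    and xy: "x \<in> carrier V" "y \<in> carrier V"
  shows "F x y = \<ominus>\<^bsub>W\<^esub> F y x"
proof -
  interpret V: module R V by fact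
  interpret W: module R W by fact
  note closed = bilin_maps_closed[OF F]
  have "F (x \<oplus>\<^bsub>V\<^esub> y) (x \<oplus>\<^bsub>V\<^esub> y) = (F x x \<oplus>\<^bsub>W\<^esub> F y x) \<oplus>\<^bsub>W\<^esub> (F x y \<oplus>\<^bsub>W\<^esub> F y y)"
    using xy by (simp add: bilin_maps_simps[OF F])
  then have "F x y \<oplus>\<^bsub>W\<^esub> F y x = \<zero>\<^bsub>W\<^esub>"
    using xy by (simp add: alt closed W.M.a_comm)
  then show ?thesis
    using xy by (simp add: closed W.M.minus_equality)
qed

text \<open>The cyclic sum is the kernel part of the Jacobi identity for a bracket twisted by
  \<open>F\<close>. It carries no signs; its agreement with the signed Chevalley-Eilenberg
  coboundary is \<open>lie_2cocycle_iff\<close>.\<close>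

definition lie_2cocycle ::
  "('r, 'x) ring_scheme \<Rightarrow> ('r, 'l, 'y) module_scheme \<Rightarrow> ('l \<Rightarrow> 'l \<Rightarrow> 'l) \<Rightarrow>
   ('r, 'm, 'z) module_scheme \<Rightarrow> ('l \<Rightarrow> 'm \<Rightarrow> 'm) \<Rightarrow> ('l \<Rightarrow> 'l \<Rightarrow> 'm) \<Rightarrow> bool" where
  "lie_2cocycle R L br M act F \<longleftrightarrow>
     F \<in> bilin_maps R L L M \<and> (\<forall>a\<in>carrier L. F a a = \<zero>\<^bsub>M\<^esub>) \<and>
     (\<forall>a\<in>carrier L. \<forall>b\<in>carrier L. \<forall>c\<in>carrier L.
        (act a (F b c) \<oplus>\<^bsub>M\<^esub> act b (F c a) \<oplus>\<^bsub>M\<^esub> act c (F a b)) \<oplus>\<^bsub>M\<^esub>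
        (F a (br b c) \<oplus>\<^bsub>M\<^esub> F b (br c a) \<oplus>\<^bsub>M\<^esub> F c (br a b)) = \<zero>\<^bsub>M\<^esub>)"

text \<open>A relation and not a function, because \<open>F\<close> is determined only on the
  carrier of \<open>L\<close>; the equation avoids both a subtraction and an inverse of
  \<open>i\<close>.\<close>

definition factor_of ::
  "('r, 'l, 'y) module_scheme \<Rightarrow> ('l \<Rightarrow> 'l \<Rightarrow> 'l) \<Rightarrow> ('r, 'm, 'z) module_scheme \<Rightarrow>
   ('r, 'b, 'w) module_scheme \<Rightarrow> ('b \<Rightarrow> 'b \<Rightarrow> 'b) \<Rightarrow> ('m \<Rightarrow> 'b) \<Rightarrow> ('l \<Rightarrow> 'b) \<Rightarrow> ('l \<Rightarrow> 'l \<Rightarrow> 'm) \<Rightarrow> bool"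
  where
  "factor_of L br M B brB i s F \<longleftrightarrow> (\<forall>a\<in>carrier L. \<forall>b\<in>carrier L.
     F a b \<in> carrier M \<and> brB (s a) (s b) = i (F a b) \<oplus>\<^bsub>B\<^esub> s (br a b))"

text \<open>One level of a Green functor and its module; the locales built on it are instantiated
  once for the level of the whole group and once for the trivial subgroup.\<close>

locale lie_pair =
  L: lie_algebra R L br + N: lie_left_module R L br M act
  for R :: "('r, 'x) ring_scheme" and L :: "('r, 'l, 'y) module_scheme" and br
    and M :: "('r, 'm, 'z) module_scheme" and act
begin

sublocale VL: module R L by (rule L.is_module)
sublocale VM: module R M by (rule N.is_module)

lemmas br_simps = bilin_maps_simps[OF L.bilinear]
lemmas act_simps = bilin_maps_simps[OF N.bilinear]

lemmas act_minus_right = lin_maps_minus[OF N.is_module N.is_module bilin_maps_right[OF N.bilinear]]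
lemmas act_zero_right = lin_maps_zero[OF N.is_module N.is_module bilin_maps_right[OF N.bilinear]]
lemmas act_zero_left = lin_maps_zero[OF L.is_module N.is_module bilin_maps_left[OF N.bilinear]]

lemma br_skew: "\<lbrakk>x \<in> carrier L; y \<in> carrier L\<rbrakk> \<Longrightarrow> br x y = \<ominus>\<^bsub>L\<^esub> br y x"
  using alternating_skew[OF L.is_module L.is_module L.bilinear L.alternating] .

end

locale lie_extension =
  lie_pair R L br M act + B: lie_algebra R B brB
  for R :: "('r, 'x) ring_scheme" and L :: "('r, 'l, 'y) module_scheme" and br
    and M :: "('r, 'm, 'z) module_scheme" and act
    and B :: "('r, 'b, 'w) module_scheme" and brB +
  fixes i j
  assumes i_lin: "i \<in> lin_maps R M B"
    and j_lie: "j \<in> lie_homs R B brB L br"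
    and exact: "short_exact M i B j L"
    and abelian: "\<lbrakk>u \<in> carrier M; v \<in> carrier M\<rbrakk> \<Longrightarrow> brB (i u) (i v) = \<zero>\<^bsub>B\<^esub>"
    and br_inc: "\<lbrakk>b \<in> carrier B; u \<in> carrier M\<rbrakk> \<Longrightarrow> brB b (i u) = i (act (j b) u)"
begin

sublocale VB: module R B by (rule B.is_module)

lemmas brB_simps = bilin_maps_simps[OF B.bilinear]

lemma brB_skew: "\<lbrakk>x \<in> carrier B; y \<in> carrier B\<rbrakk> \<Longrightarrow> brB x y = \<ominus>\<^bsub>B\<^esub> brB y x"
  using alternating_skew[OF B.is_module B.is_module B.bilinear B.alternating] .

lemma j_lin: "j \<in> lin_maps R B L"
  using j_lie by (simp add: lie_homs_def)

lemmas i_simps = lin_maps_closed[OF i_lin] lin_maps_add[OF i_lin]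
  lin_maps_minus[OF N.is_module B.is_module i_lin] lin_maps_neg[OF N.is_module B.is_module i_lin]
  lin_maps_zero[OF N.is_module B.is_module i_lin]

lemmas j_simps = lin_maps_closed[OF j_lin] lin_maps_add[OF j_lin]
  lin_maps_minus[OF B.is_module L.is_module j_lin] lin_maps_neg[OF B.is_module L.is_module j_lin]
  lin_maps_zero[OF B.is_module L.is_module j_lin]

lemma j_br: "\<lbrakk>x \<in> carrier B; y \<in> carrier B\<rbrakk> \<Longrightarrow> j (brB x y) = br (j x) (j y)"
  using j_lie by (simp add: lie_homs_def)

lemma inj_i: "inj_on i (carrier M)"
  using exact by (simp add: short_exact_def)

lemma j_i: "u \<in> carrier M \<Longrightarrow> j (i u) = \<zero>\<^bsub>L\<^esub>"
  using exact by (auto simp: short_exact_def)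

lemma kernel_j: "\<lbrakk>b \<in> carrier B; j b = \<zero>\<^bsub>L\<^esub>\<rbrakk> \<Longrightarrow> \<exists>u\<in>carrier M. i u = b"
  using exact unfolding short_exact_def by (metis (mono_tags, lifting) imageE mem_Collect_eq)

end

locale lie_section = lie_extension R L br M act B brB i j
  for R :: "('r, 'x) ring_scheme" and L :: "('r, 'l, 'y) module_scheme" and br
    and M :: "('r, 'm, 'z) module_scheme" and act
    and B :: "('r, 'b, 'w) module_scheme" and brB i j +
  fixes s
  assumes s_lin: "s \<in> lin_maps R L B"
    and j_s: "a \<in> carrier L \<Longrightarrow> j (s a) = a"
begin

lemmas s_simps = lin_maps_closed[OF s_lin] lin_maps_add[OF s_lin]
  lin_maps_minus[OF L.is_module B.is_module s_lin] lin_maps_neg[OF L.is_module B.is_module s_lin]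
  lin_maps_zero[OF L.is_module B.is_module s_lin]

text \<open>The projection of \<open>B\<close> onto the kernel along \<open>s\<close>. Inverting
  \<open>i\<close> is legitimate here: \<open>j\<close> kills \<open>b - s (j b)\<close>, and the
  sequence is exact at \<open>B\<close>.\<close>

definition retract :: "'b \<Rightarrow> 'm" where
  "retract b = inv_into (carrier M) i (b \<ominus>\<^bsub>B\<^esub> s (j b))"

lemma retract:
  assumes b: "b \<in> carrier B"
  shows retract_closed: "retract b \<in> carrier M"
    and i_retract: "i (retract b) = b \<ominus>\<^bsub>B\<^esub> s (j b)"
proof -
  have "j (b \<ominus>\<^bsub>B\<^esub> s (j b)) = \<zero>\<^bsub>L\<^esub>"
    using b by (simp add: j_simps s_simps j_s VL.M.minus_eq VL.M.r_neg)
  then have "b \<ominus>\<^bsub>B\<^esub> s (j b) \<in> i ` carrier M"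
    using kernel_j[of "b \<ominus>\<^bsub>B\<^esub> s (j b)"] b by (force simp: j_simps s_simps)
  then show "retract b \<in> carrier M" "i (retract b) = b \<ominus>\<^bsub>B\<^esub> s (j b)"
    by (simp_all add: retract_def inv_into_into f_inv_into_f)
qed

lemma decomposition: "b \<in> carrier B \<Longrightarrow> i (retract b) \<oplus>\<^bsub>B\<^esub> s (j b) = b"
  by (simp add: i_retract VB.M.minus_eq VB.M.a_assoc VB.M.l_neg j_simps s_simps)

lemma j_decomposed: "\<lbrakk>m \<in> carrier M; a \<in> carrier L\<rbrakk> \<Longrightarrow> j (i m \<oplus>\<^bsub>B\<^esub> s a) = a"
  by (simp add: j_simps i_simps s_simps j_i j_s)

lemma retract_decomposed:
  assumes "m \<in> carrier M" "a \<in> carrier L"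
  shows "retract (i m \<oplus>\<^bsub>B\<^esub> s a) = m"
  by (rule inj_onD[OF inj_i])
    (simp_all add: assms retract i_simps s_simps j_decomposed VB.M.minus_eq VB.M.a_assoc VB.M.r_neg)

text \<open>Since \<open>j\<close> preserves brackets and splits \<open>s\<close>, \<open>j\<close>
  sends \<open>[s a, s b]\<close> to \<open>[a, b]\<close>. The section part of
  \<open>[s a, s b]\<close> is thus \<open>s [a, b]\<close>, and its retraction is the factor
  set.\<close>

lemma ex_factor: "\<lbrakk>a \<in> carrier L; b \<in> carrier L\<rbrakk> \<Longrightarrow>
    retract (brB (s a) (s b)) \<in> carrier M \<and>
    brB (s a) (s b) = i (retract (brB (s a) (s b))) \<oplus>\<^bsub>B\<^esub> s (br a b)"
  using decomposition[of "brB (s a) (s b)"] retract[of "brB (s a) (s b)"]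
  by (simp add: brB_simps s_simps j_br j_s)

lemma factor_of_retract: "factor_of L br M B brB i s (\<lambda>a b. retract (brB (s a) (s b)))"
  using ex_factor by (simp add: factor_of_def)

end

locale lie_factor = lie_section R L br M act B brB i j s
  for R :: "('r, 'x) ring_scheme" and L :: "('r, 'l, 'y) module_scheme" and br
    and M :: "('r, 'm, 'z) module_scheme" and act
    and B :: "('r, 'b, 'w) module_scheme" and brB i j s +
  fixes F
  assumes factor: "factor_of L br M B brB i s F"
begin

lemma F_closed: "\<lbrakk>a \<in> carrier L; b \<in> carrier L\<rbrakk> \<Longrightarrow> F a b \<in> carrier M"
  and br_section: "\<lbrakk>a \<in> carrier L; b \<in> carrier L\<rbrakk> \<Longrightarrow>
    brB (s a) (s b) = i (F a b) \<oplus>\<^bsub>B\<^esub> s (br a b)"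
  using factor by (auto simp: factor_of_def)

lemma i_F: "\<lbrakk>a \<in> carrier L; b \<in> carrier L\<rbrakk> \<Longrightarrow> i (F a b) = brB (s a) (s b) \<ominus>\<^bsub>B\<^esub> s (br a b)"
  by (simp add: br_section F_closed i_simps s_simps br_simps VB.M.minus_eq VB.M.a_assoc VB.M.r_neg)

text \<open>Kernel against kernel contributes nothing, and the mixed brackets are given by the
  action, one of them with a sign from skewness. In coordinates the bracket depends only on
  \<open>act\<close>, \<open>br\<close> and \<open>F\<close>; this is why a factor set determines
  the extension, and it is the origin of \<open>twisted_bracket\<close>.\<close>

lemma br_decomposed:
  assumes "m \<in> carrier M" "m' \<in> carrier M" "a \<in> carrier L" "a' \<in> carrier L"
  shows "brB (i m \<oplus>\<^bsub>B\<^esub> s a) (i m' \<oplus>\<^bsub>B\<^esub> s a') =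
    i ((act a m' \<ominus>\<^bsub>M\<^esub> act a' m) \<oplus>\<^bsub>M\<^esub> F a a') \<oplus>\<^bsub>B\<^esub> s (br a a')"
proof -
  have "brB (i m) (s a') = \<ominus>\<^bsub>B\<^esub> i (act a' m)"
    using assms brB_skew[of "i m" "s a'"] by (simp add: i_simps s_simps br_inc j_s)
  then show ?thesis
    using assms
    by (simp add: brB_simps i_simps s_simps abelian br_inc br_section j_s j_decomposed F_closed
        act_simps br_simps VB.M.minus_eq VB.M.a_ac)
qed

text \<open>The Jacobi identity of \<open>B\<close> at \<open>s a\<close>, \<open>s b\<close>,
  \<open>s c\<close> has a kernel part and a section part. The latter is \<open>s\<close> of the
  Jacobi sum of \<open>L\<close>, so the former vanishes on its own.\<close>

lemma factor_cocycle: "lie_2cocycle R L br M act F"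
  unfolding lie_2cocycle_def
proof (intro conjI ballI)
  show "F \<in> bilin_maps R L L M"
  proof (rule bilin_mapsI)
    fix x y assume "x \<in> carrier L" "y \<in> carrier L" then show "F x y \<in> carrier M" by (rule F_closed)
  \<comment> \<open>Under \<open>i\<close>, \<open>F\<close> becomes a difference of two bilinear
    expressions, so the four remaining identities can be verified in \<open>B\<close>.\<close>
  qed (rule inj_onD[OF inj_i];
      simp add: i_simps i_F F_closed s_simps br_simps brB_simps lin_maps_smult[OF s_lin]
        lin_maps_smult[OF i_lin] VB.M.minus_eq VB.M.minus_add VB.M.a_ac VB.smult_r_distr
        VB.smult_r_minus)+
next
  fix a assume "a \<in> carrier L"
  then show "F a a = \<zero>\<^bsub>M\<^esub>"
    by (intro inj_onD[OF inj_i])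
      (simp_all add: i_F F_closed i_simps L.alternating B.alternating s_simps VB.M.minus_eq)
next
  fix a b c assume abc: "a \<in> carrier L" "b \<in> carrier L" "c \<in> carrier L"
  \<comment> \<open>The kernel part of the inner bracket returns as the action of \<open>x\<close>;
    its section part yields the factor at \<open>(x, [y, z])\<close>.\<close>
  have 1: "brB (s x) (brB (s y) (s z)) =
      (i (act x (F y z)) \<oplus>\<^bsub>B\<^esub> i (F x (br y z))) \<oplus>\<^bsub>B\<^esub> s (br x (br y z))"
    if "x \<in> carrier L" "y \<in> carrier L" "z \<in> carrier L" for x y z
    using that
    by (simp add: br_section brB_simps br_simps i_simps s_simps F_closed br_inc j_s act_simps
        VB.M.a_assoc)
  let ?S = "(act a (F b c) \<oplus>\<^bsub>M\<^esub> act b (F c a) \<oplus>\<^bsub>M\<^esub> act c (F a b)) \<oplus>\<^bsub>M\<^esub>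
        (F a (br b c) \<oplus>\<^bsub>M\<^esub> F b (br c a) \<oplus>\<^bsub>M\<^esub> F c (br a b))"
  have "\<zero>\<^bsub>B\<^esub> = brB (s a) (brB (s b) (s c)) \<oplus>\<^bsub>B\<^esub> brB (s b) (brB (s c) (s a)) \<oplus>\<^bsub>B\<^esub>
      brB (s c) (brB (s a) (s b))"
    using abc by (simp add: B.jacobi s_simps)
  also have "\<dots> = i ?S \<oplus>\<^bsub>B\<^esub> s (br a (br b c) \<oplus>\<^bsub>L\<^esub> br b (br c a) \<oplus>\<^bsub>L\<^esub> br c (br a b))"
    using abc by (simp only: 1)
      (simp add: i_simps s_simps br_simps act_simps F_closed VB.M.a_ac)
  also have "\<dots> = i ?S"
    using abc by (simp add: L.jacobi s_simps i_simps br_simps act_simps F_closed)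
  finally show "?S = \<zero>\<^bsub>M\<^esub>"
    using abc by (intro inj_onD[OF inj_i]) (simp_all add: i_simps br_simps act_simps F_closed)
qed

text \<open>Take \<open>h a\<close> and \<open>h b\<close> as kernel components in
  \<open>br_decomposed\<close>. The new section at \<open>[a, b]\<close> already contains
  \<open>h [a, b]\<close>, which must be subtracted from the kernel part; what is then added to
  \<open>F\<close> is the coboundary of \<open>h\<close>.\<close>

lemma factor_of_shift:
  assumes h: "h \<in> lin_maps R L M"
  shows "factor_of L br M B brB i (\<lambda>a. i (h a) \<oplus>\<^bsub>B\<^esub> s a)
    (\<lambda>a b. (act a (h b) \<ominus>\<^bsub>M\<^esub> act b (h a) \<ominus>\<^bsub>M\<^esub> h (br a b)) \<oplus>\<^bsub>M\<^esub> F a b)"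
  unfolding factor_of_def
proof (intro ballI conjI)
  fix a b assume ab: "a \<in> carrier L" "b \<in> carrier L"
  note [simp] = ab lin_maps_closed[OF h] act_simps br_simps F_closed
  show "(act a (h b) \<ominus>\<^bsub>M\<^esub> act b (h a) \<ominus>\<^bsub>M\<^esub> h (br a b)) \<oplus>\<^bsub>M\<^esub> F a b \<in> carrier M"
    by simp
  have "(act a (h b) \<ominus>\<^bsub>M\<^esub> act b (h a)) \<oplus>\<^bsub>M\<^esub> F a b =
    ((act a (h b) \<ominus>\<^bsub>M\<^esub> act b (h a) \<ominus>\<^bsub>M\<^esub> h (br a b)) \<oplus>\<^bsub>M\<^esub> F a b) \<oplus>\<^bsub>M\<^esub> h (br a b)"
    by (simp add: VM.M.minus_eq VM.M.a_ac VM.M.a_lcomm[of "h (br a b)" "\<ominus>\<^bsub>M\<^esub> act b (h a)"]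
        VM.M.r_neg)
  then show "brB (i (h a) \<oplus>\<^bsub>B\<^esub> s a) (i (h b) \<oplus>\<^bsub>B\<^esub> s b) =
    i ((act a (h b) \<ominus>\<^bsub>M\<^esub> act b (h a) \<ominus>\<^bsub>M\<^esub> h (br a b)) \<oplus>\<^bsub>M\<^esub> F a b) \<oplus>\<^bsub>B\<^esub>
      (i (h (br a b)) \<oplus>\<^bsub>B\<^esub> s (br a b))"
    by (simp add: br_decomposed) (simp add: i_simps s_simps VB.M.a_assoc)
qed

end

lemma factor_of_unique:
  assumes "lie_factor R L br M act B brB i j s F" "lie_factor R L br M act B brB i j s G"
    and "a \<in> carrier L" "b \<in> carrier L"
  shows "F a b = G a b"
proof -
  interpret F: lie_factor R L br M act B brB i j s F by fact
  interpret G: lie_factor R L br M act B brB i j s G by fact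
  show ?thesis
    using assms(3,4) by (intro inj_onD[OF F.inj_i]) (simp_all add: F.i_F G.i_F F.F_closed G.F_closed)
qed

section \<open>The extension defined by a cocycle\<close>

text \<open>The product is transported along an injection \<open>\<phi>\<close> of the product carrier, because the middle
  term of an extension has to live in a prescribed type.\<close>

definition unpack :: "('m \<times> 'l \<Rightarrow> 'b) \<Rightarrow> ('m, 'x) partial_object_scheme \<Rightarrow>
    ('l, 'y) partial_object_scheme \<Rightarrow> 'b \<Rightarrow> 'm \<times> 'l" where
  "unpack \<phi> M L = inv_into (carrier M \<times> carrier L) \<phi>"

definition twisted_module :: "('m \<times> 'l \<Rightarrow> 'b) \<Rightarrow> ('r, 'm, 'x) module_scheme \<Rightarrow>
    ('r, 'l, 'y) module_scheme \<Rightarrow> ('r, 'b) module" where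
  "twisted_module \<phi> M L =
    \<lparr>carrier = \<phi> ` (carrier M \<times> carrier L),
     monoid.mult = (\<lambda>x y. x),
     one = \<phi> (\<zero>\<^bsub>M\<^esub>, \<zero>\<^bsub>L\<^esub>),
     zero = \<phi> (\<zero>\<^bsub>M\<^esub>, \<zero>\<^bsub>L\<^esub>),
     add = (\<lambda>x y. \<phi> (fst (unpack \<phi> M L x) \<oplus>\<^bsub>M\<^esub> fst (unpack \<phi> M L y),
       snd (unpack \<phi> M L x) \<oplus>\<^bsub>L\<^esub> snd (unpack \<phi> M L y))),
     smult = (\<lambda>k x. \<phi> (k \<odot>\<^bsub>M\<^esub> fst (unpack \<phi> M L x), k \<odot>\<^bsub>L\<^esub> snd (unpack \<phi> M L x)))\<rparr>"

text \<open>The coordinate formula of \<open>br_decomposed\<close>: given an abelian kernel, the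
  action and the factor set \<open>F\<close> of the section sending \<open>a\<close> to
  \<open>(0, a)\<close>, no other bracket is possible.\<close>

definition twisted_bracket :: "('m \<times> 'l \<Rightarrow> 'b) \<Rightarrow> ('r, 'm, 'x) module_scheme \<Rightarrow>
    ('r, 'l, 'y) module_scheme \<Rightarrow> ('l \<Rightarrow> 'l \<Rightarrow> 'l) \<Rightarrow> ('l \<Rightarrow> 'm \<Rightarrow> 'm) \<Rightarrow> ('l \<Rightarrow> 'l \<Rightarrow> 'm) \<Rightarrow>
    'b \<Rightarrow> 'b \<Rightarrow> 'b" where
  "twisted_bracket \<phi> M L br act F x y =
    (let (m, a) = unpack \<phi> M L x; (n, b) = unpack \<phi> M L y
     in \<phi> ((act a n \<ominus>\<^bsub>M\<^esub> act b m) \<oplus>\<^bsub>M\<^esub> F a b, br a b))"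

section \<open>The direct sum of two modules, carried over to another type\<close>

locale transport =
  VL: module R L + VM: module R M
  for R :: "('r, 'x) ring_scheme" and L :: "('r, 'l, 'y) module_scheme"
    and M :: "('r, 'm, 'z) module_scheme" +
  fixes \<phi> :: "'m \<times> 'l \<Rightarrow> 'b"
  assumes inj: "inj_on \<phi> (carrier M \<times> carrier L)"
begin

abbreviation "T \<equiv> twisted_module \<phi> M L"

lemma neg_zero: "\<ominus>\<^bsub>M\<^esub> \<zero>\<^bsub>M\<^esub> = \<zero>\<^bsub>M\<^esub>"
  by (rule VM.M.minus_equality) simp_all

lemma unpack [simp]: "\<lbrakk>m \<in> carrier M; a \<in> carrier L\<rbrakk> \<Longrightarrow> unpack \<phi> M L (\<phi> (m, a)) = (m, a)"
  using inj by (simp add: unpack_def inv_into_f_f)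

lemma twisted_closed [simp]: "\<lbrakk>m \<in> carrier M; a \<in> carrier L\<rbrakk> \<Longrightarrow> \<phi> (m, a) \<in> carrier T"
  by (simp add: twisted_module_def)

lemma twisted_cases:
  assumes "x \<in> carrier T"
  obtains m a where "m \<in> carrier M" "a \<in> carrier L" "x = \<phi> (m, a)"
  using assms by (auto simp: twisted_module_def)

lemma twisted_eq_iff:
  "\<lbrakk>m \<in> carrier M; a \<in> carrier L; m' \<in> carrier M; a' \<in> carrier L\<rbrakk> \<Longrightarrow>
    \<phi> (m, a) = \<phi> (m', a') \<longleftrightarrow> m = m' \<and> a = a'"
  using inj by (auto dest: inj_onD)

lemma zero_twisted [simp]: "\<zero>\<^bsub>T\<^esub> = \<phi> (\<zero>\<^bsub>M\<^esub>, \<zero>\<^bsub>L\<^esub>)"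
  by (simp add: twisted_module_def)

lemma add_twisted [simp]:
  "\<lbrakk>m \<in> carrier M; a \<in> carrier L; m' \<in> carrier M; a' \<in> carrier L\<rbrakk> \<Longrightarrow>
    \<phi> (m, a) \<oplus>\<^bsub>T\<^esub> \<phi> (m', a') = \<phi> (m \<oplus>\<^bsub>M\<^esub> m', a \<oplus>\<^bsub>L\<^esub> a')"
  by (simp add: twisted_module_def)

lemma smult_twisted [simp]:
  "\<lbrakk>m \<in> carrier M; a \<in> carrier L\<rbrakk> \<Longrightarrow> k \<odot>\<^bsub>T\<^esub> \<phi> (m, a) = \<phi> (k \<odot>\<^bsub>M\<^esub> m, k \<odot>\<^bsub>L\<^esub> a)"
  by (simp add: twisted_module_def)

lemma module_twisted: "module R T"
proof (rule moduleI)
  show "abelian_group T"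
  proof (rule abelian_groupI)
    fix x assume "x \<in> carrier T"
    then obtain m a where x: "m \<in> carrier M" "a \<in> carrier L" "x = \<phi> (m, a)"
      by (rule twisted_cases)
    then have "\<phi> (\<ominus>\<^bsub>M\<^esub> m, \<ominus>\<^bsub>L\<^esub> a) \<oplus>\<^bsub>T\<^esub> x = \<zero>\<^bsub>T\<^esub>"
      by (simp add: VL.M.l_neg VM.M.l_neg)
    then show "\<exists>y\<in>carrier T. y \<oplus>\<^bsub>T\<^esub> x = \<zero>\<^bsub>T\<^esub>"
      using x by (meson twisted_closed VL.M.a_inv_closed VM.M.a_inv_closed)
  qed (auto elim!: twisted_cases simp: VL.M.a_ac VM.M.a_ac)
qed (auto elim!: twisted_cases simp: VL.smult_l_distr VM.smult_l_distr VL.smult_r_distr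
    VM.smult_r_distr VL.smult_assoc1 VM.smult_assoc1 VL.is_cring)

lemma snd_unpack_lin: "(\<lambda>x. snd (unpack \<phi> M L x)) \<in> lin_maps R T L"
  by (rule lin_mapsI) (auto elim!: twisted_cases)

lemma inl_lin: "(\<lambda>m. \<phi> (m, \<zero>\<^bsub>L\<^esub>)) \<in> lin_maps R M T"
  and inr_lin: "(\<lambda>a. \<phi> (\<zero>\<^bsub>M\<^esub>, a)) \<in> lin_maps R L T"
  by (rule lin_mapsI; simp)+

lemma short_exact_twisted:
  "short_exact M (\<lambda>m. \<phi> (m, \<zero>\<^bsub>L\<^esub>)) T (\<lambda>x. snd (unpack \<phi> M L x)) L"
  unfolding short_exact_def
proof (intro conjI)
  show "inj_on (\<lambda>m. \<phi> (m, \<zero>\<^bsub>L\<^esub>)) (carrier M)"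
    by (auto intro!: inj_onI simp: twisted_eq_iff)
  show "(\<lambda>m. \<phi> (m, \<zero>\<^bsub>L\<^esub>)) ` carrier M = {b \<in> carrier T. snd (unpack \<phi> M L b) = \<zero>\<^bsub>L\<^esub>}"
    by (auto elim!: twisted_cases)
  show "(\<lambda>x. snd (unpack \<phi> M L x)) ` carrier T = carrier L"
  proof
    show "carrier L \<subseteq> (\<lambda>x. snd (unpack \<phi> M L x)) ` carrier T"
    proof
      fix a assume "a \<in> carrier L"
      then show "a \<in> (\<lambda>x. snd (unpack \<phi> M L x)) ` carrier T"
        by (intro image_eqI[where x = "\<phi> (\<zero>\<^bsub>M\<^esub>, a)"]) simp_all
    qed
  qed (auto elim!: twisted_cases)
qed

text \<open>Prepares the Mackey axiom that restriction after transfer is the sum of the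
  conjugations: on the product that sum has to be taken in each coordinate.\<close>

lemma finsum_twisted:
  assumes "finite A" "f \<in> A \<rightarrow> carrier M" "g \<in> A \<rightarrow> carrier L"
  shows "(\<Oplus>\<^bsub>T\<^esub>x\<in>A. \<phi> (f x, g x)) = \<phi> (\<Oplus>\<^bsub>M\<^esub>x\<in>A. f x, \<Oplus>\<^bsub>L\<^esub>x\<in>A. g x)"
proof -
  interpret VT: module R T by (rule module_twisted)
  show ?thesis
    using assms
    by (induction A rule: finite_induct)
      (auto simp: Pi_def VT.M.finsum_insert VL.M.finsum_insert VM.M.finsum_insert
        VL.M.finsum_closed VM.M.finsum_closed)
qed

end

section \<open>The Lie bracket twisted by a cocycle\<close>

locale twisted_lie_extension =
  lie_pair R L br M act + transport R L M \<phi>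
  for R :: "('r, 'x) ring_scheme" and L :: "('r, 'l, 'y) module_scheme" and br
    and M :: "('r, 'm, 'z) module_scheme" and act and \<phi> :: "'m \<times> 'l \<Rightarrow> 'b" +
  fixes F
  assumes cocycle: "lie_2cocycle R L br M act F"
begin

abbreviation "brT \<equiv> twisted_bracket \<phi> M L br act F"

lemma F_bilin: "F \<in> bilin_maps R L L M"
  and F_alt: "a \<in> carrier L \<Longrightarrow> F a a = \<zero>\<^bsub>M\<^esub>"
  and F_cyclic: "\<lbrakk>a \<in> carrier L; b \<in> carrier L; c \<in> carrier L\<rbrakk> \<Longrightarrow>
    (act a (F b c) \<oplus>\<^bsub>M\<^esub> act b (F c a) \<oplus>\<^bsub>M\<^esub> act c (F a b)) \<oplus>\<^bsub>M\<^esub>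
    (F a (br b c) \<oplus>\<^bsub>M\<^esub> F b (br c a) \<oplus>\<^bsub>M\<^esub> F c (br a b)) = \<zero>\<^bsub>M\<^esub>"
  using cocycle by (auto simp: lie_2cocycle_def)

lemmas F_simps = bilin_maps_simps[OF F_bilin]
lemmas F_zero_right = lin_maps_zero[OF L.is_module N.is_module bilin_maps_right[OF F_bilin]]
lemmas br_zero_right = lin_maps_zero[OF L.is_module L.is_module bilin_maps_right[OF L.bilinear]]

lemma bracket_twisted [simp]:
  "\<lbrakk>m \<in> carrier M; a \<in> carrier L; n \<in> carrier M; b \<in> carrier L\<rbrakk> \<Longrightarrow>
    brT (\<phi> (m, a)) (\<phi> (n, b)) = \<phi> ((act a n \<ominus>\<^bsub>M\<^esub> act b m) \<oplus>\<^bsub>M\<^esub> F a b, br a b)"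
  by (simp add: twisted_bracket_def)

text \<open>The kernel coordinate of the Jacobi sum at \<open>(m, a)\<close>, \<open>(n, b)\<close>,
  \<open>(k, c)\<close>, with its terms abstracted. \<open>x1\<close> to \<open>x6\<close> stand for
  the iterated actions \<open>a (b k)\<close>, \<open>a (c n)\<close>, \<open>b (c m)\<close>,
  \<open>c (b m)\<close>, \<open>b (a k)\<close>, \<open>c (a n)\<close>. Each occurs twice with
  opposite signs, once from acting on the kernel part of an inner bracket and once from expanding
  the action of a bracket. The \<open>f\<close> and \<open>g\<close> terms make up the cocycle
  sum.\<close>

lemma cyclic_cancel:
  assumes "x1 \<in> carrier M" "x2 \<in> carrier M" "x3 \<in> carrier M" "x4 \<in> carrier M" "x5 \<in> carrier M" "x6 \<in> carrier M"
    "f1 \<in> carrier M" "f2 \<in> carrier M" "f3 \<in> carrier M" "g1 \<in> carrier M" "g2 \<in> carrier M" "g3 \<in> carrier M"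
    and "(f1 \<oplus>\<^bsub>M\<^esub> f2 \<oplus>\<^bsub>M\<^esub> f3) \<oplus>\<^bsub>M\<^esub> (g1 \<oplus>\<^bsub>M\<^esub> g2 \<oplus>\<^bsub>M\<^esub> g3) = \<zero>\<^bsub>M\<^esub>"
  shows "((x1 \<ominus>\<^bsub>M\<^esub> x2 \<oplus>\<^bsub>M\<^esub> f1) \<ominus>\<^bsub>M\<^esub> (x3 \<ominus>\<^bsub>M\<^esub> x4) \<oplus>\<^bsub>M\<^esub> g1) \<oplus>\<^bsub>M\<^esub>
    ((x3 \<ominus>\<^bsub>M\<^esub> x5 \<oplus>\<^bsub>M\<^esub> f2) \<ominus>\<^bsub>M\<^esub> (x6 \<ominus>\<^bsub>M\<^esub> x2) \<oplus>\<^bsub>M\<^esub> g2) \<oplus>\<^bsub>M\<^esub>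
    ((x6 \<ominus>\<^bsub>M\<^esub> x4 \<oplus>\<^bsub>M\<^esub> f3) \<ominus>\<^bsub>M\<^esub> (x1 \<ominus>\<^bsub>M\<^esub> x5) \<oplus>\<^bsub>M\<^esub> g3) = \<zero>\<^bsub>M\<^esub>"
proof -
  note [simp] = assms(1-12)
  have "((x1 \<ominus>\<^bsub>M\<^esub> x2 \<oplus>\<^bsub>M\<^esub> f1) \<ominus>\<^bsub>M\<^esub> (x3 \<ominus>\<^bsub>M\<^esub> x4) \<oplus>\<^bsub>M\<^esub> g1) \<oplus>\<^bsub>M\<^esub>
    ((x3 \<ominus>\<^bsub>M\<^esub> x5 \<oplus>\<^bsub>M\<^esub> f2) \<ominus>\<^bsub>M\<^esub> (x6 \<ominus>\<^bsub>M\<^esub> x2) \<oplus>\<^bsub>M\<^esub> g2) \<oplus>\<^bsub>M\<^esub>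
    ((x6 \<ominus>\<^bsub>M\<^esub> x4 \<oplus>\<^bsub>M\<^esub> f3) \<ominus>\<^bsub>M\<^esub> (x1 \<ominus>\<^bsub>M\<^esub> x5) \<oplus>\<^bsub>M\<^esub> g3) =
    ((f1 \<oplus>\<^bsub>M\<^esub> f2 \<oplus>\<^bsub>M\<^esub> f3) \<oplus>\<^bsub>M\<^esub> (g1 \<oplus>\<^bsub>M\<^esub> g2 \<oplus>\<^bsub>M\<^esub> g3)) \<oplus>\<^bsub>M\<^esub>
    ((x1 \<ominus>\<^bsub>M\<^esub> x1) \<oplus>\<^bsub>M\<^esub> ((x2 \<ominus>\<^bsub>M\<^esub> x2) \<oplus>\<^bsub>M\<^esub> ((x3 \<ominus>\<^bsub>M\<^esub> x3) \<oplus>\<^bsub>M\<^esub>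
      ((x4 \<ominus>\<^bsub>M\<^esub> x4) \<oplus>\<^bsub>M\<^esub> ((x5 \<ominus>\<^bsub>M\<^esub> x5) \<oplus>\<^bsub>M\<^esub> (x6 \<ominus>\<^bsub>M\<^esub> x6))))))"
    by (simp add: VM.M.minus_eq VM.M.minus_add VM.M.a_ac)
  also have "\<dots> = \<zero>\<^bsub>M\<^esub>"
    by (simp add: assms(13) VM.M.minus_eq VM.M.r_neg)
  finally show ?thesis .
qed

lemma lie_algebra_twisted: "lie_algebra R T brT"
proof (rule lie_algebra.intro)
  show "module R T" by (rule module_twisted)
  show "brT \<in> bilin_maps R T T T"
    by (rule bilin_mapsI)
      (auto elim!: twisted_cases simp: act_simps br_simps F_simps VM.smult_r_distr VM.smult_r_minus
        VM.M.minus_eq VM.M.minus_add VM.M.a_ac)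
next
  fix x assume "x \<in> carrier T"
  then show "brT x x = \<zero>\<^bsub>T\<^esub>"
    by (auto elim!: twisted_cases simp: F_alt L.alternating act_simps VM.M.minus_eq VM.M.r_neg)
next
  fix x y z assume "x \<in> carrier T" "y \<in> carrier T" "z \<in> carrier T"
  then obtain m a n b k c where
    mem [simp]: "m \<in> carrier M" "a \<in> carrier L" "n \<in> carrier M" "b \<in> carrier L" "k \<in> carrier M"
      "c \<in> carrier L"
    and xyz: "x = \<phi> (m, a)" "y = \<phi> (n, b)" "z = \<phi> (k, c)"
    by (auto elim!: twisted_cases)
  note [simp] = act_simps br_simps F_simps
  show "brT x (brT y z) \<oplus>\<^bsub>T\<^esub> brT y (brT z x) \<oplus>\<^bsub>T\<^esub> brT z (brT x y) = \<zero>\<^bsub>T\<^esub>"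
    unfolding xyz
    by (simp add: act_minus_right L.jacobi N.bracket_act twisted_eq_iff cyclic_cancel F_cyclic)
qed

text \<open>With the twisted product as an instance of the general situation, its exactness, abelian
  kernel and induced action are available in the form in which \<open>singular_extension\<close>
  asks for them.\<close>

sublocale lie_section R L br M act T brT "\<lambda>m. \<phi> (m, \<zero>\<^bsub>L\<^esub>)" "\<lambda>x. snd (unpack \<phi> M L x)"
    "\<lambda>a. \<phi> (\<zero>\<^bsub>M\<^esub>, a)"
proof -
  interpret B: lie_algebra R T brT by (rule lie_algebra_twisted)
  show "lie_section R L br M act T brT (\<lambda>m. \<phi> (m, \<zero>\<^bsub>L\<^esub>)) (\<lambda>x. snd (unpack \<phi> M L x))
      (\<lambda>a. \<phi> (\<zero>\<^bsub>M\<^esub>, a))"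
  proof unfold_locales
    show "(\<lambda>x. snd (unpack \<phi> M L x)) \<in> lie_homs R T brT L br"
      by (auto simp: lie_homs_def snd_unpack_lin br_simps act_simps F_simps elim!: twisted_cases)
  qed (auto elim!: twisted_cases intro: inl_lin inr_lin short_exact_twisted
      simp: act_simps act_zero_left F_alt L.alternating F_zero_right br_zero_right VM.M.minus_eq neg_zero)
qed

text \<open>In \<open>[(0, a), (0, b)]\<close> both action terms act on zero, which leaves
  \<open>F a b\<close> alone in the kernel coordinate.\<close>

lemma factor_of_twisted:
  "factor_of L br M T brT (\<lambda>m. \<phi> (m, \<zero>\<^bsub>L\<^esub>)) (\<lambda>a. \<phi> (\<zero>\<^bsub>M\<^esub>, a)) F"
  by (simp add: factor_of_def act_simps br_simps F_simps act_zero_right VM.M.minus_eq neg_zero)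

end

section \<open>Cochains of degree one and two\<close>

lemma tuples_1: "xs \<in> tuples V (Suc 0) \<longleftrightarrow> (\<exists>a\<in>carrier V. xs = [a])"
  by (auto simp: tuples_def length_Suc_conv)

lemma tuples_2: "xs \<in> tuples V 2 \<longleftrightarrow> (\<exists>a\<in>carrier V. \<exists>b\<in>carrier V. xs = [a, b])"
  by (auto simp: tuples_def length_Suc_conv numeral_2_eq_2)

lemma tuples_3:
  "xs \<in> tuples V 3 \<longleftrightarrow> (\<exists>a\<in>carrier V. \<exists>b\<in>carrier V. \<exists>c\<in>carrier V. xs = [a, b, c])"
  by (auto simp: tuples_def length_Suc_conv numeral_3_eq_3)

lemma tuples_simps [simp]:
  "[a] \<in> tuples V (Suc 0) \<longleftrightarrow> a \<in> carrier V"
  "[a, b] \<in> tuples V 2 \<longleftrightarrow> a \<in> carrier V \<and> b \<in> carrier V"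
  "[a, b, c] \<in> tuples V 3 \<longleftrightarrow> a \<in> carrier V \<and> b \<in> carrier V \<and> c \<in> carrier V"
  by (auto simp: tuples_def)

lemma ball_tuples:
  "(\<forall>xs\<in>tuples V (Suc 0). P xs) \<longleftrightarrow> (\<forall>a\<in>carrier V. P [a])"
  "(\<forall>xs\<in>tuples V 2. P xs) \<longleftrightarrow> (\<forall>a\<in>carrier V. \<forall>b\<in>carrier V. P [a, b])"
  "(\<forall>xs\<in>tuples V 3. P xs) \<longleftrightarrow>
    (\<forall>a\<in>carrier V. \<forall>b\<in>carrier V. \<forall>c\<in>carrier V. P [a, b, c])"
  by (auto simp: tuples_1 tuples_2 tuples_3)

lemma all_less_2: "(\<forall>i<(2::nat). P i) \<longleftrightarrow> P 0 \<and> P 1"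
  by (auto simp: less_2_cases_iff)

lemma extensional_tuples_2_eqI:
  assumes "f \<in> extensional (tuples V 2)" "g \<in> extensional (tuples V 2)"
    and "\<And>a b. \<lbrakk>a \<in> carrier V; b \<in> carrier V\<rbrakk> \<Longrightarrow> f [a, b] = g [a, b]"
  shows "f = g"
  using assms(3) by (intro extensionalityI[OF assms(1,2)]) (auto simp: tuples_2)

lemma alt_maps_extensional: "f \<in> alt_maps R V W n \<Longrightarrow> f \<in> extensional (tuples V n)"
  by (simp add: alt_maps_def PiE_def)

lemma alt_maps_1_iff:
  assumes "module R V"
  shows "f \<in> alt_maps R V W (Suc 0) \<longleftrightarrow>
    f \<in> extensional (tuples V (Suc 0)) \<and> (\<lambda>a. f [a]) \<in> lin_maps R V W"
proof -
  interpret V: module R V by fact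
  \<comment> \<open>\<open>alt_maps\<close> states linearity in a slot by overwriting an entry of a
    given tuple; a point of the carrier must first fill that slot.\<close>
  have "carrier V \<noteq> {}" using V.M.zero_closed by blast
  moreover have "f [a] \<in> carrier W" if "(\<lambda>a. f [a]) \<in> lin_maps R V W" "a \<in> carrier V" for a
    using lin_maps_closed[OF that] .
  ultimately show ?thesis
    by (auto simp: alt_maps_def PiE_def Pi_iff ball_tuples)
qed

lemma alt_maps_2_iff:
  assumes "module R V"
  shows "f \<in> alt_maps R V W 2 \<longleftrightarrow>
    f \<in> extensional (tuples V 2) \<and> (\<lambda>a b. f [a, b]) \<in> bilin_maps R V V W \<and>
    (\<forall>a\<in>carrier V. f [a, a] = \<zero>\<^bsub>W\<^esub>)"
proof -
  interpret V: module R V by fact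
  have "carrier V \<noteq> {}" using V.M.zero_closed by blast
  moreover have "f [a, b] \<in> carrier W"
    if "\<forall>x\<in>carrier V. (\<lambda>b. f [x, b]) \<in> lin_maps R V W" "a \<in> carrier V" "b \<in> carrier V" for a b
    using lin_maps_closed[OF that(1)[rule_format, OF that(2)] that(3)] .
  ultimately show ?thesis
    by (auto simp: alt_maps_def bilin_maps_def PiE_def Pi_iff ball_tuples all_less_2)
qed

lemma del_nth_simps:
  "del_nth 0 (x # xs) = xs" "del_nth (Suc n) (x # xs) = x # del_nth n xs"
  "del_nth (numeral k) (x # xs) = x # del_nth (pred_numeral k) xs"
  by (simp_all add: del_nth_def numeral_eq_Suc)

context lie_pair
begin

lemma ce_delta_1:
  assumes h: "(\<lambda>a. h [a]) \<in> lin_maps R L M" and ab: "a \<in> carrier L" "b \<in> carrier L"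
  shows "ce_delta L br M act (Suc 0) h [a, b] =
    act a (h [b]) \<ominus>\<^bsub>M\<^esub> act b (h [a]) \<ominus>\<^bsub>M\<^esub> h [br a b]"
proof -
  have 1: "{..Suc 0} = {0, 1}" by auto
  have 2: "{(i, j). i < j \<and> j \<le> Suc 0} = {(0, 1)}" by auto
  note [simp] = ab lin_maps_closed[OF h] act_simps br_simps
  have "[a, b] \<in> tuples L (Suc (Suc 0))" by (simp add: tuples_def)
  then show ?thesis
    unfolding ce_delta_def 1 2
    by (simp add: VM.M.finsum_insert alt_sign_def del_nth_simps VM.M.minus_eq)
qed

text \<open>The expanded coboundary is \<open>a f(b,c) - b f(a,c) + c f(a,b) - f([a,b],c) +
  f([a,c],b) - f([b,c],a)\<close>. Skewness of \<open>f\<close>, a consequence of alternation,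
  absorbs the minus signs and makes the sum cyclic.\<close>

lemma ce_delta_2:
  assumes F: "(\<lambda>a b. f [a, b]) \<in> bilin_maps R L L M"
    and alt: "\<And>a. a \<in> carrier L \<Longrightarrow> f [a, a] = \<zero>\<^bsub>M\<^esub>"
    and abc: "a \<in> carrier L" "b \<in> carrier L" "c \<in> carrier L"
  shows "ce_delta L br M act 2 f [a, b, c] =
    (act a (f [b, c]) \<oplus>\<^bsub>M\<^esub> act b (f [c, a]) \<oplus>\<^bsub>M\<^esub> act c (f [a, b])) \<oplus>\<^bsub>M\<^esub>
    (f [a, br b c] \<oplus>\<^bsub>M\<^esub> f [b, br c a] \<oplus>\<^bsub>M\<^esub> f [c, br a b])"
proof -
  have 1: "{..2::nat} = {0, 1, 2}" by auto
  have 2: "{(i, j). i < j \<and> j \<le> (2::nat)} = {(0, 1), (0, 2), (1, 2)}" by auto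
  note [simp] = abc bilin_maps_closed[OF F] act_simps br_simps
  have skew: "f [x, y] = \<ominus>\<^bsub>M\<^esub> f [y, x]" if "x \<in> carrier L" "y \<in> carrier L" for x y
    using alternating_skew[OF L.is_module N.is_module F alt that] .
  \<comment> \<open>This term enters with a plus sign, so exchanging the arguments of
    \<open>f\<close> must be balanced by a second sign change, from skewness of the bracket.\<close>
  have "f [br a c, b] = \<ominus>\<^bsub>M\<^esub> f [br c a, b]"
    using lin_maps_neg[OF L.is_module N.is_module bilin_maps_left[OF F abc(2)], of "br c a"]
    by (simp add: br_skew[of a c])
  then have eqs: "f [br a c, b] = f [b, br c a]"
    "\<ominus>\<^bsub>M\<^esub> f [br a b, c] = f [c, br a b]" "\<ominus>\<^bsub>M\<^esub> f [br b c, a] = f [a, br b c]"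
    "\<ominus>\<^bsub>M\<^esub> act b (f [a, c]) = act b (f [c, a])"
    by (simp_all add: skew[of b "br c a"] skew[of c "br a b"] skew[of a "br b c"] skew[of c a]
        lin_maps_neg[OF N.is_module N.is_module bilin_maps_right[OF N.bilinear]])
  have "[a, b, c] \<in> tuples L (Suc 2)" by (simp add: tuples_def)
  then show ?thesis
    unfolding ce_delta_def 1 2
    by (simp add: VM.M.finsum_insert alt_sign_def del_nth_simps)
      (simp add: eqs VM.M.a_ac)
qed

lemma lie_2cocycle_iff:
  assumes "f \<in> alt_maps R L M 2"
  shows "lie_2cocycle R L br M act (\<lambda>a b. f [a, b]) \<longleftrightarrow>
    ce_delta L br M act 2 f = (\<lambda>as\<in>tuples L 3. \<zero>\<^bsub>M\<^esub>)"
proof -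
  have F: "(\<lambda>a b. f [a, b]) \<in> bilin_maps R L L M"
    and alt: "\<And>a. a \<in> carrier L \<Longrightarrow> f [a, a] = \<zero>\<^bsub>M\<^esub>"
    using assms by (auto simp: alt_maps_2_iff[OF L.is_module])
  \<comment> \<open>Both functions are restricted to triples, so their equality only concerns values
    at triples.\<close>
  have "ce_delta L br M act 2 f = (\<lambda>as\<in>tuples L 3. \<zero>\<^bsub>M\<^esub>) \<longleftrightarrow>
    (\<forall>xs\<in>tuples L 3. ce_delta L br M act 2 f xs = \<zero>\<^bsub>M\<^esub>)"
    by (auto simp: fun_eq_iff ce_delta_def restrict_def)
  also have "\<dots> \<longleftrightarrow> lie_2cocycle R L br M act (\<lambda>a b. f [a, b])"
    using F alt by (simp add: lie_2cocycle_def ball_tuples ce_delta_2)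
  finally show ?thesis by simp
qed

end

lemma mackey_morphism_cong:
  assumes "mackey_functor R p A"
    and "\<And>x. x \<in> carrier (modC A) \<Longrightarrow> fC x = gC x"
    and "\<And>x. x \<in> carrier (modE A) \<Longrightarrow> fE x = gE x"
  shows "mackey_morphism R p A B fC fE \<longleftrightarrow> mackey_morphism R p A B gC gE"
proof -
  interpret A: mackey_functor R p A by fact
  have "fC \<in> lin_maps R (modC A) (modC B) \<longleftrightarrow> gC \<in> lin_maps R (modC A) (modC B)"
    "fE \<in> lin_maps R (modE A) (modE B) \<longleftrightarrow> gE \<in> lin_maps R (modE A) (modE B)"
    using assms(2,3) by (intro lin_maps_cong A.module_C A.module_E; simp)+
  then show ?thesis
    unfolding mackey_morphism_def
    by (simp add: assms(2,3) lin_maps_closed[OF A.res_lin] lin_maps_closed[OF A.tr_lin]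
        lin_maps_closed[OF A.cj_lin])
qed

text \<open>The conditions of \<open>cochains\<close> that link the structure maps of
  \<open>L\<close> and \<open>M\<close>, for degree two and in curried form. The Frobenius relation
  is listed for both slots because alternation is not part of this definition.\<close>

definition mackey_bilinear ::
  "nat \<Rightarrow> ('r, 'la, 'lb, 'y) mackey_scheme \<Rightarrow> ('r, 'a, 'b, 'z) mackey_scheme \<Rightarrow>
   ('la \<Rightarrow> 'la \<Rightarrow> 'a) \<Rightarrow> ('lb \<Rightarrow> 'lb \<Rightarrow> 'b) \<Rightarrow> bool" where
  "mackey_bilinear p L M FC FE \<longleftrightarrow>
     (\<forall>a\<in>carrier (modC L). \<forall>b\<in>carrier (modC L).
        res M (FC a b) = FE (res L a) (res L b)) \<and>
     (\<forall>g\<in>carrier (integer_mod_group p). \<forall>x\<in>carrier (modE L). \<forall>y\<in>carrier (modE L).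
        cj M g (FE x y) = FE (cj L g x) (cj L g y)) \<and>
     (\<forall>x\<in>carrier (modE L). \<forall>b\<in>carrier (modC L).
        FC (tr L x) b = tr M (FE x (res L b)) \<and> FC b (tr L x) = tr M (FE (res L b) x))"

section \<open>Cochains, cocycles and coboundaries over a Green functor\<close>

locale green_pair =
  L: green_lie_functor R p L + M: green_left_module R p L M
  for R :: "('r, 'x) ring_scheme" and p :: nat
    and L :: "('r, 'la, 'lb, 'y) green_lie_scheme"
    and M :: "('r, 'la, 'lb, 'a, 'b, 'z) green_bimod_scheme"
begin

sublocale C: lie_pair R "modC L" "brC L" "modC M" "lactC M"
  by (intro lie_pair.intro L.lie_C M.left_C)

sublocale E: lie_pair R "modE L" "brE L" "modE M" "lactE M"
  by (intro lie_pair.intro L.lie_E M.left_E)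

lemmas L_closed = lin_maps_closed[OF L.res_lin] lin_maps_closed[OF L.tr_lin]
  lin_maps_closed[OF L.cj_lin]
lemmas M_closed = lin_maps_closed[OF M.res_lin] lin_maps_closed[OF M.tr_lin]
  lin_maps_closed[OF M.cj_lin]

text \<open>In degree one alternation is vacuous, and the Frobenius relation says that transfer is
  respected.\<close>

lemma cochains_1_iff: "(hC, hE) \<in> cochains R p L M (Suc 0) \<longleftrightarrow>
    hC \<in> extensional (tuples (modC L) (Suc 0)) \<and> hE \<in> extensional (tuples (modE L) (Suc 0)) \<and>
    mackey_morphism R p L M (\<lambda>a. hC [a]) (\<lambda>x. hE [x])"
  by (auto simp: cochains_def mackey_morphism_def alt_maps_1_iff L.module_C L.module_E ball_tuples)

lemma cochains_2_iff: "(fC, fE) \<in> cochains R p L M 2 \<longleftrightarrow>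
    fC \<in> alt_maps R (modC L) (modC M) 2 \<and> fE \<in> alt_maps R (modE L) (modE M) 2 \<and>
    mackey_bilinear p L M (\<lambda>a b. fC [a, b]) (\<lambda>x y. fE [x, y])"
proof -
  have "carrier (modC L) \<noteq> {}" using C.VL.M.zero_closed by blast
  then show ?thesis
    by (auto simp: cochains_def mackey_bilinear_def ball_tuples all_less_2)
qed

text \<open>Bilinearity and alternation are contained in \<open>lie_2cocycle\<close>, so of
  \<open>alt_maps\<close> only extensionality has to be listed separately.\<close>

lemma kernel_coboundary_iff:
  "(fC, fE) \<in> kernel (cochain_group R p L M 2) (cochain_group R p L M 3) (coboundary L M 2) \<longleftrightarrow>
    fC \<in> extensional (tuples (modC L) 2) \<and> fE \<in> extensional (tuples (modE L) 2) \<and>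
    lie_2cocycle R (modC L) (brC L) (modC M) (lactC M) (\<lambda>a b. fC [a, b]) \<and>
    lie_2cocycle R (modE L) (brE L) (modE M) (lactE M) (\<lambda>x y. fE [x, y]) \<and>
    mackey_bilinear p L M (\<lambda>a b. fC [a, b]) (\<lambda>x y. fE [x, y])"
proof -
  have "fC \<in> alt_maps R (modC L) (modC M) 2"
    if "fC \<in> extensional (tuples (modC L) 2)"
      "lie_2cocycle R (modC L) (brC L) (modC M) (lactC M) (\<lambda>a b. fC [a, b])"
    using that by (simp add: alt_maps_2_iff L.module_C lie_2cocycle_def)
  moreover have "fE \<in> alt_maps R (modE L) (modE M) 2"
    if "fE \<in> extensional (tuples (modE L) 2)"
      "lie_2cocycle R (modE L) (brE L) (modE M) (lactE M) (\<lambda>a b. fE [a, b])"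
    using that by (simp add: alt_maps_2_iff L.module_E lie_2cocycle_def)
  ultimately show ?thesis
    unfolding kernel_def cochain_group_def coboundary_def
    by (auto simp: alt_maps_extensional cochains_2_iff C.lie_2cocycle_iff E.lie_2cocycle_iff)
qed

text \<open>The coset of \<open>f\<close> modulo coboundaries, written with morphisms on elements in
  place of functions of one-element lists. These are the expressions by which a factor set changes
  in \<open>factor_of_shift\<close>.\<close>

definition cohomologous_cochains ::
  "('la list \<Rightarrow> 'a) \<times> ('lb list \<Rightarrow> 'b) \<Rightarrow> (('la list \<Rightarrow> 'a) \<times> ('lb list \<Rightarrow> 'b)) set" where
  "cohomologous_cochains = (\<lambda>(fC, fE). {(gC, gE).
     gC \<in> extensional (tuples (modC L) 2) \<and> gE \<in> extensional (tuples (modE L) 2) \<and>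
     (\<exists>hC hE. mackey_morphism R p L M hC hE \<and>
       (\<forall>a\<in>carrier (modC L). \<forall>b\<in>carrier (modC L). gC [a, b] =
         (lactC M a (hC b) \<ominus>\<^bsub>modC M\<^esub> lactC M b (hC a) \<ominus>\<^bsub>modC M\<^esub> hC (brC L a b))
         \<oplus>\<^bsub>modC M\<^esub> fC [a, b]) \<and>
       (\<forall>x\<in>carrier (modE L). \<forall>y\<in>carrier (modE L). gE [x, y] =
         (lactE M x (hE y) \<ominus>\<^bsub>modE M\<^esub> lactE M y (hE x) \<ominus>\<^bsub>modE M\<^esub> hE (brE L x y))
         \<oplus>\<^bsub>modE M\<^esub> fE [x, y]))})"

text \<open>A right coset is formed from the multiplication, which an update of the carrier leaves
  alone; so \<open>K\<close> is arbitrary and can later be the kernel. \<open>Suc 0\<close> appears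
  because the simplifier writes 1 in this way.\<close>

lemma coset_coboundaries:
  "(coboundary L M (Suc 0) ` carrier (cochain_group R p L M (Suc 0)))
     #>\<^bsub>(cochain_group R p L M 2)\<lparr>carrier := K\<rparr>\<^esub> f = cohomologous_cochains f"
proof -
  obtain fC fE where f: "f = (fC, fE)" by (cases f)
  have coset: "(coboundary L M (Suc 0) ` carrier (cochain_group R p L M (Suc 0)))
     #>\<^bsub>(cochain_group R p L M 2)\<lparr>carrier := K\<rparr>\<^esub> f =
    {(\<lambda>as\<in>tuples (modC L) 2. ce_delta (modC L) (brC L) (modC M) (lactC M) (Suc 0) hC as \<oplus>\<^bsub>modC M\<^esub> fC as,
      \<lambda>xs\<in>tuples (modE L) 2. ce_delta (modE L) (brE L) (modE M) (lactE M) (Suc 0) hE xs \<oplus>\<^bsub>modE M\<^esub> fE xs)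
     | hC hE. (hC, hE) \<in> cochains R p L M (Suc 0)}" (is "_ = ?S")
    unfolding r_coset_def cochain_group_def coboundary_def f by force
  have "?S = cohomologous_cochains (fC, fE)"
  proof (intro equalityI subsetI)
    fix g assume "g \<in> ?S"
    then obtain hC hE where h: "(hC, hE) \<in> cochains R p L M (Suc 0)" and g: "g =
      (\<lambda>as\<in>tuples (modC L) 2. ce_delta (modC L) (brC L) (modC M) (lactC M) (Suc 0) hC as \<oplus>\<^bsub>modC M\<^esub> fC as,
      \<lambda>xs\<in>tuples (modE L) 2. ce_delta (modE L) (brE L) (modE M) (lactE M) (Suc 0) hE xs \<oplus>\<^bsub>modE M\<^esub> fE xs)"
      by auto
    have m: "mackey_morphism R p L M (\<lambda>a. hC [a]) (\<lambda>x. hE [x])"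
      using h by (simp only: cochains_1_iff)
    then have lin: "(\<lambda>a. hC [a]) \<in> lin_maps R (modC L) (modC M)" "(\<lambda>x. hE [x]) \<in> lin_maps R (modE L) (modE M)"
      by (simp_all add: mackey_morphism_def)
    from m C.ce_delta_1[OF lin(1)] E.ce_delta_1[OF lin(2)] show "g \<in> cohomologous_cochains (fC, fE)"
      unfolding cohomologous_cochains_def g
      by (auto intro!: exI[of _ "\<lambda>a. hC [a]"] exI[of _ "\<lambda>x. hE [x]"])
  next
    fix g assume "g \<in> cohomologous_cochains (fC, fE)"
    then obtain gC gE hC hE where g: "g = (gC, gE)"
      and ext: "gC \<in> extensional (tuples (modC L) 2)" "gE \<in> extensional (tuples (modE L) 2)"
      and h: "mackey_morphism R p L M hC hE"
      and eqC: "\<And>a b. \<lbrakk>a \<in> carrier (modC L); b \<in> carrier (modC L)\<rbrakk> \<Longrightarrow> gC [a, b] =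
         (lactC M a (hC b) \<ominus>\<^bsub>modC M\<^esub> lactC M b (hC a) \<ominus>\<^bsub>modC M\<^esub> hC (brC L a b))
         \<oplus>\<^bsub>modC M\<^esub> fC [a, b]"
      and eqE: "\<And>x y. \<lbrakk>x \<in> carrier (modE L); y \<in> carrier (modE L)\<rbrakk> \<Longrightarrow> gE [x, y] =
         (lactE M x (hE y) \<ominus>\<^bsub>modE M\<^esub> lactE M y (hE x) \<ominus>\<^bsub>modE M\<^esub> hE (brE L x y))
         \<oplus>\<^bsub>modE M\<^esub> fE [x, y]"
      unfolding cohomologous_cochains_def by auto
    \<comment> \<open>A morphism on elements becomes a 1-cochain: \<open>hd\<close> reads the entry
      of a one-element list, and the restriction provides extensionality.\<close>
    define kC where "kC = (\<lambda>as\<in>tuples (modC L) (Suc 0). hC (hd as))"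
    define kE where "kE = (\<lambda>xs\<in>tuples (modE L) (Suc 0). hE (hd xs))"
    have k: "a \<in> carrier (modC L) \<Longrightarrow> kC [a] = hC a" "x \<in> carrier (modE L) \<Longrightarrow> kE [x] = hE x" for a x
      by (simp_all add: kC_def kE_def)
    have m: "mackey_morphism R p L M (\<lambda>a. kC [a]) (\<lambda>x. kE [x])"
      using h by (subst mackey_morphism_cong[OF L.mackey_functor_axioms k])
    then have "(kC, kE) \<in> cochains R p L M (Suc 0)"
      unfolding cochains_1_iff by (simp add: kC_def kE_def)
    moreover have lin: "(\<lambda>a. kC [a]) \<in> lin_maps R (modC L) (modC M)"
        "(\<lambda>x. kE [x]) \<in> lin_maps R (modE L) (modE M)"
      using m by (simp_all add: mackey_morphism_def)
    have "gC = (\<lambda>as\<in>tuples (modC L) 2.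
        ce_delta (modC L) (brC L) (modC M) (lactC M) (Suc 0) kC as \<oplus>\<^bsub>modC M\<^esub> fC as)"
      by (rule extensional_tuples_2_eqI[OF ext(1)])
        (use lin in \<open>simp_all add: C.ce_delta_1 k C.br_simps eqC\<close>)
    moreover have "gE = (\<lambda>xs\<in>tuples (modE L) 2.
        ce_delta (modE L) (brE L) (modE M) (lactE M) (Suc 0) kE xs \<oplus>\<^bsub>modE M\<^esub> fE xs)"
      by (rule extensional_tuples_2_eqI[OF ext(2)])
        (use lin in \<open>simp_all add: E.ce_delta_1 k E.br_simps eqE\<close>)
    ultimately show "g \<in> ?S" using g by blast
  qed
  then show ?thesis using coset f by simp
qed

text \<open>Elements of the quotient are literally sets of cochains. By
  \<open>factor_sets_eq\<close> extensions give sets of the same form, so both sides of the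
  correspondence can be compared as sets.\<close>

lemma carrier_H2:
  "carrier (H2_Green_Lie R p L M) = cohomologous_cochains `
    kernel (cochain_group R p L M 2) (cochain_group R p L M 3) (coboundary L M 2)"
  unfolding H2_Green_Lie_def FactGroup_def RCOSETS_def One_nat_def coset_coboundaries
  by auto

end

section \<open>Factor sets of an extension of Green functors\<close>

lemma factor_of_cong:
  assumes "lie_algebra R L br"
    and "\<And>a. a \<in> carrier L \<Longrightarrow> s a = s' a"
    and "\<And>a b. \<lbrakk>a \<in> carrier L; b \<in> carrier L\<rbrakk> \<Longrightarrow> F a b = F' a b"
  shows "factor_of L br M B brB i s F \<longleftrightarrow> factor_of L br M B brB i s' F'"
proof -
  interpret lie_algebra R L br by fact
  show ?thesis
    by (simp add: factor_of_def assms(2,3) bilin_maps_closed[OF bilinear])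
qed

text \<open>In the coordinates of a section, \<open>br_decomposed\<close> computes both brackets
  from the same \<open>act\<close>, \<open>br\<close> and \<open>F\<close>; a map that keeps
  coordinates therefore preserves them.\<close>

lemma lie_factor_isomorphism:
  assumes X: "lie_factor R L br M act B brB i j s F"
    and Y: "lie_factor R L br M act B' brB' i' j' s' F"
    and \<beta>: "\<And>b. b \<in> carrier B \<Longrightarrow>
      \<beta> b = i' (lie_section.retract M B i j s b) \<oplus>\<^bsub>B'\<^esub> s' (j b)"
  shows "\<lbrakk>b \<in> carrier B; c \<in> carrier B\<rbrakk> \<Longrightarrow> \<beta> (brB b c) = brB' (\<beta> b) (\<beta> c)"
    and "bij_betw \<beta> (carrier B) (carrier B')"
    and "u \<in> carrier M \<Longrightarrow> \<beta> (i u) = i' u"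
    and "b \<in> carrier B \<Longrightarrow> j' (\<beta> b) = j b"
proof -
  interpret X: lie_factor R L br M act B brB i j s F by fact
  interpret Y: lie_factor R L br M act B' brB' i' j' s' F by fact
  have \<beta>_decomposed: "\<beta> (i m \<oplus>\<^bsub>B\<^esub> s a) = i' m \<oplus>\<^bsub>B'\<^esub> s' a"
    if "m \<in> carrier M" "a \<in> carrier L" for m a
    using that by (simp add: \<beta> X.i_simps X.s_simps X.retract_decomposed X.j_decomposed)
  have decompose: "\<exists>m\<in>carrier M. \<exists>a\<in>carrier L. b = i m \<oplus>\<^bsub>B\<^esub> s a" if "b \<in> carrier B" for b
    using X.decomposition[OF that] X.retract_closed[OF that] X.j_simps(1)[OF that] by metis
  show "\<beta> (brB b c) = brB' (\<beta> b) (\<beta> c)" if "b \<in> carrier B" "c \<in> carrier B"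
    using decompose[OF that(1)] decompose[OF that(2)]
    by (auto simp: \<beta>_decomposed X.br_decomposed Y.br_decomposed X.act_simps X.br_simps X.F_closed)
  show j': "j' (\<beta> b) = j b" if "b \<in> carrier B" for b
    using decompose[OF that] by (auto simp: \<beta>_decomposed Y.j_decomposed X.j_decomposed)
  show "\<beta> (i u) = i' u" if "u \<in> carrier M"
    using \<beta>_decomposed[OF that X.VL.M.zero_closed] that
    by (simp add: X.s_simps Y.s_simps X.i_simps Y.i_simps)
  show "bij_betw \<beta> (carrier B) (carrier B')"
  \<comment> \<open>The inverse keeps coordinates in the other direction: the same formula with the
    two extensions exchanged.\<close>
  proof (rule bij_betwI[where g = "\<lambda>b. i (Y.retract b) \<oplus>\<^bsub>B\<^esub> s (j' b)"])
    show "\<beta> \<in> carrier B \<rightarrow> carrier B'"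
      using decompose by (force simp: \<beta>_decomposed Y.i_simps Y.s_simps)
    show "(\<lambda>b. i (Y.retract b) \<oplus>\<^bsub>B\<^esub> s (j' b)) \<in> carrier B' \<rightarrow> carrier B"
      by (simp add: X.i_simps X.s_simps Y.retract_closed Y.j_simps)
    show "i (Y.retract (\<beta> b)) \<oplus>\<^bsub>B\<^esub> s (j' (\<beta> b)) = b" if "b \<in> carrier B" for b
      using decompose[OF that] by (auto simp: \<beta>_decomposed Y.retract_decomposed Y.j_decomposed)
    show "\<beta> (i (Y.retract b) \<oplus>\<^bsub>B\<^esub> s (j' b)) = b" if "b \<in> carrier B'" for b
      using that by (simp add: \<beta>_decomposed Y.retract_closed Y.j_simps Y.decomposition)
  qed
qed

text \<open>Names the witnesses of \<open>M_split\<close>, since the factor set depends on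
  them.\<close>

definition mackey_section ::
  "('r, 'x) ring_scheme \<Rightarrow> nat \<Rightarrow> ('r, 'la, 'lb, 'y) green_lie_scheme \<Rightarrow>
   ('r, 'la, 'lb, 'ma, 'mb, 'ba, 'bb) extension \<Rightarrow> ('la \<Rightarrow> 'ba) \<Rightarrow> ('lb \<Rightarrow> 'bb) \<Rightarrow> bool" where
  "mackey_section R p L X sC sE \<longleftrightarrow> mackey_morphism R p L (mid X) sC sE \<and>
     (\<forall>a\<in>carrier (modC L). projC X (sC a) = a) \<and>
     (\<forall>x\<in>carrier (modE L). projE X (sE x) = x)"

definition has_factors ::
  "('r, 'la, 'lb, 'y) green_lie_scheme \<Rightarrow> ('r, 'la, 'lb, 'ma, 'mb, 'z) green_bimod_scheme \<Rightarrow>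
   ('r, 'la, 'lb, 'ma, 'mb, 'ba, 'bb) extension \<Rightarrow> ('la \<Rightarrow> 'ba) \<Rightarrow> ('lb \<Rightarrow> 'bb) \<Rightarrow>
   ('la \<Rightarrow> 'la \<Rightarrow> 'ma) \<Rightarrow> ('lb \<Rightarrow> 'lb \<Rightarrow> 'mb) \<Rightarrow> bool" where
  "has_factors L M X sC sE FC FE \<longleftrightarrow>
     factor_of (modC L) (brC L) (modC M) (modC (mid X)) (brC (mid X)) (incC X) sC FC \<and>
     factor_of (modE L) (brE L) (modE M) (modE (mid X)) (brE (mid X)) (incE X) sE FE"

definition factor_sets ::
  "('r, 'x) ring_scheme \<Rightarrow> nat \<Rightarrow> ('r, 'la, 'lb, 'y) green_lie_scheme \<Rightarrow>
   ('r, 'la, 'lb, 'ma, 'mb, 'z) green_bimod_scheme \<Rightarrow>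
   ('r, 'la, 'lb, 'ma, 'mb, 'ba, 'bb) extension \<Rightarrow>
   (('la list \<Rightarrow> 'ma) \<times> ('lb list \<Rightarrow> 'mb)) set" where
  "factor_sets R p L M X = {(fC, fE).
     fC \<in> extensional (tuples (modC L) 2) \<and> fE \<in> extensional (tuples (modE L) 2) \<and>
     (\<exists>sC sE. mackey_section R p L X sC sE \<and>
       has_factors L M X sC sE (\<lambda>a b. fC [a, b]) (\<lambda>x y. fE [x, y]))}"

section \<open>Sections and retractions at both levels\<close>

locale green_extension =
  green_pair R p L M
  for R :: "('r, 'x) ring_scheme" and p :: nat
    and L :: "('r, 'la, 'lb, 'y) green_lie_scheme"
    and M :: "('r, 'la, 'lb, 'ma, 'mb, 'z) green_bimod_scheme" +
  fixes X :: "('r, 'la, 'lb, 'ma, 'mb, 'ba, 'bb) extension"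
  assumes extension: "singular_extension R p L M X"
begin

sublocale B: green_lie_functor R p "mid X"
  using extension by (simp add: singular_extension_def)

sublocale CX: lie_extension R "modC L" "brC L" "modC M" "lactC M" "modC (mid X)" "brC (mid X)"
    "incC X" "projC X"
  using extension
  by (intro lie_extension.intro lie_extension_axioms.intro C.lie_pair_axioms B.lie_C)
    (auto simp: singular_extension_def mackey_morphism_def green_lie_morphism_def)

sublocale EX: lie_extension R "modE L" "brE L" "modE M" "lactE M" "modE (mid X)" "brE (mid X)"
    "incE X" "projE X"
  using extension
  by (intro lie_extension.intro lie_extension_axioms.intro E.lie_pair_axioms B.lie_E)
    (auto simp: singular_extension_def mackey_morphism_def green_lie_morphism_def)

lemma inc_morphism: "mackey_morphism R p M (mid X) (incC X) (incE X)"
  and proj_morphism: "mackey_morphism R p (mid X) L (projC X) (projE X)"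
  using extension by (simp_all add: singular_extension_def green_lie_morphism_def)

lemma inc_commute:
  "m \<in> carrier (modC M) \<Longrightarrow> incE X (res M m) = res (mid X) (incC X m)"
  "u \<in> carrier (modE M) \<Longrightarrow> incC X (tr M u) = tr (mid X) (incE X u)"
  "\<lbrakk>g \<in> carrier (integer_mod_group p); u \<in> carrier (modE M)\<rbrakk> \<Longrightarrow>
    incE X (cj M g u) = cj (mid X) g (incE X u)"
  using inc_morphism by (simp_all add: mackey_morphism_def)

end

locale green_section = green_extension R p L M X
  for R :: "('r, 'x) ring_scheme" and p :: nat
    and L :: "('r, 'la, 'lb, 'y) green_lie_scheme"
    and M :: "('r, 'la, 'lb, 'ma, 'mb, 'z) green_bimod_scheme"
    and X :: "('r, 'la, 'lb, 'ma, 'mb, 'ba, 'bb) extension" +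
  fixes sC sE
  assumes is_section: "mackey_section R p L X sC sE"
begin

lemma section_morphism: "mackey_morphism R p L (mid X) sC sE"
  using is_section by (simp add: mackey_section_def)

sublocale SC: lie_section R "modC L" "brC L" "modC M" "lactC M" "modC (mid X)" "brC (mid X)"
    "incC X" "projC X" sC
  using is_section by unfold_locales (auto simp: mackey_section_def mackey_morphism_def)

sublocale SE: lie_section R "modE L" "brE L" "modE M" "lactE M" "modE (mid X)" "brE (mid X)"
    "incE X" "projE X" sE
  using is_section by unfold_locales (auto simp: mackey_section_def mackey_morphism_def)

lemma section_commute:
  "a \<in> carrier (modC L) \<Longrightarrow> sE (res L a) = res (mid X) (sC a)"
  "x \<in> carrier (modE L) \<Longrightarrow> sC (tr L x) = tr (mid X) (sE x)"
  "\<lbrakk>g \<in> carrier (integer_mod_group p); x \<in> carrier (modE L)\<rbrakk> \<Longrightarrow>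
    sE (cj L g x) = cj (mid X) g (sE x)"
  using section_morphism by (simp_all add: mackey_morphism_def)

text \<open>The identity minus the section after the projection is a Mackey endomorphism of the
  middle term with values in the image of \<open>M\<close>; the retraction is its factorisation
  through the inclusion.\<close>

lemma retract_morphism: "mackey_morphism R p (mid X) M SC.retract SE.retract"
proof (rule mackey_morphism_factor[where iC = "incC X" and iE = "incE X"])
  show "mackey_morphism R p (mid X) (mid X) (\<lambda>b. b \<ominus>\<^bsub>modC (mid X)\<^esub> sC (projC X b))
      (\<lambda>b. b \<ominus>\<^bsub>modE (mid X)\<^esub> sE (projE X b))"
    by (intro mackey_morphism_minus mackey_morphism_id B.mackey_functor_axioms
        mackey_morphism_comp[OF proj_morphism section_morphism])
qed (simp_all add: inc_morphism B.mackey_functor_axioms M.mackey_functor_axioms CX.inj_i EX.inj_i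
    SC.retract SE.retract)

lemma has_factors_retract:
  "has_factors L M X sC sE (\<lambda>a b. SC.retract (brC (mid X) (sC a) (sC b)))
    (\<lambda>x y. SE.retract (brE (mid X) (sE x) (sE y)))"
  by (simp add: has_factors_def SC.factor_of_retract SE.factor_of_retract)

end

locale green_factor = green_section R p L M X sC sE
  for R :: "('r, 'x) ring_scheme" and p :: nat
    and L :: "('r, 'la, 'lb, 'y) green_lie_scheme"
    and M :: "('r, 'la, 'lb, 'ma, 'mb, 'z) green_bimod_scheme"
    and X :: "('r, 'la, 'lb, 'ma, 'mb, 'ba, 'bb) extension" and sC sE +
  fixes FC FE
  assumes factors: "has_factors L M X sC sE FC FE"
begin

sublocale FC: lie_factor R "modC L" "brC L" "modC M" "lactC M" "modC (mid X)" "brC (mid X)"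
    "incC X" "projC X" sC FC
  using factors by unfold_locales (simp add: has_factors_def)

sublocale FE: lie_factor R "modE L" "brE L" "modE M" "lactE M" "modE (mid X)" "brE (mid X)"
    "incE X" "projE X" sE FE
  using factors by unfold_locales (simp add: has_factors_def)

text \<open>Under the inclusion a factor becomes \<open>[s a, s b] - s [a, b]\<close>. Restriction
  and conjugation preserve brackets both in \<open>L\<close> and in the middle term, and transfer
  obeys the Frobenius rules in both, so each structure map carries this difference to the required
  one.\<close>

lemma factors_mackey_bilinear: "mackey_bilinear p L M FC FE"
proof -
  note [simp] = L_closed M_closed FC.F_closed FE.F_closed C.br_simps(1) E.br_simps(1)
    SC.s_simps(1) SE.s_simps(1) CX.brB_simps(1) EX.brB_simps(1) FC.i_F FE.i_F
    lin_maps_closed[OF B.res_lin] lin_maps_closed[OF B.tr_lin] lin_maps_closed[OF B.cj_lin]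
  note minus [simp] = lin_maps_minus[OF B.module_C B.module_E B.res_lin]
    lin_maps_minus[OF B.module_E B.module_C B.tr_lin]
    lin_maps_minus[OF B.module_E B.module_E B.cj_lin]
  have lie: "\<lbrakk>a \<in> carrier (modC L); b \<in> carrier (modC L)\<rbrakk> \<Longrightarrow>
      res L (brC L a b) = brE L (res L a) (res L b)"
    "\<lbrakk>g \<in> carrier (integer_mod_group p); x \<in> carrier (modE L); y \<in> carrier (modE L)\<rbrakk> \<Longrightarrow>
      cj L g (brE L x y) = brE L (cj L g x) (cj L g y)" for a b g x y
    using L.res_lie L.cj_lie by (auto simp: lie_homs_def)
  have lie': "\<lbrakk>a \<in> carrier (modC (mid X)); b \<in> carrier (modC (mid X))\<rbrakk> \<Longrightarrow>
      res (mid X) (brC (mid X) a b) = brE (mid X) (res (mid X) a) (res (mid X) b)"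
    "\<lbrakk>g \<in> carrier (integer_mod_group p); x \<in> carrier (modE (mid X));
        y \<in> carrier (modE (mid X))\<rbrakk> \<Longrightarrow>
      cj (mid X) g (brE (mid X) x y) = brE (mid X) (cj (mid X) g x) (cj (mid X) g y)" for a b g x y
    using B.res_lie B.cj_lie by (auto simp: lie_homs_def)
  show ?thesis
    unfolding mackey_bilinear_def
  proof (intro conjI ballI)
    fix a b assume "a \<in> carrier (modC L)" "b \<in> carrier (modC L)"
    then show "res M (FC a b) = FE (res L a) (res L b)"
      by (intro inj_onD[OF EX.inj_i]) (simp_all add: inc_commute lie lie' flip: section_commute)
  next
    fix g x y assume "g \<in> carrier (integer_mod_group p)" "x \<in> carrier (modE L)" "y \<in> carrier (modE L)"
    then show "cj M g (FE x y) = FE (cj L g x) (cj L g y)"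
      by (intro inj_onD[OF EX.inj_i]) (simp_all add: inc_commute lie lie' flip: section_commute)
  next
    fix x b assume "x \<in> carrier (modE L)" "b \<in> carrier (modC L)"
    then show "FC (tr L x) b = tr M (FE x (res L b))" "FC b (tr L x) = tr M (FE (res L b) x)"
      by (intro inj_onD[OF CX.inj_i]; simp add: inc_commute section_commute L.frobenius_left
          L.frobenius_right B.frobenius_left B.frobenius_right)+
  qed
qed

text \<open>The inclusion after \<open>h\<close> has values in the kernel of the projection, so
  adding it to a section leaves a section; it is again compatible with the Mackey structure as a sum
  of morphisms.\<close>

lemma factors_shift:
  assumes h: "mackey_morphism R p L M hC hE"
  shows "mackey_section R p L X (\<lambda>a. incC X (hC a) \<oplus>\<^bsub>modC (mid X)\<^esub> sC a)
      (\<lambda>x. incE X (hE x) \<oplus>\<^bsub>modE (mid X)\<^esub> sE x)"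
    and "has_factors L M X (\<lambda>a. incC X (hC a) \<oplus>\<^bsub>modC (mid X)\<^esub> sC a)
      (\<lambda>x. incE X (hE x) \<oplus>\<^bsub>modE (mid X)\<^esub> sE x)
      (\<lambda>a b. (lactC M a (hC b) \<ominus>\<^bsub>modC M\<^esub> lactC M b (hC a) \<ominus>\<^bsub>modC M\<^esub> hC (brC L a b))
         \<oplus>\<^bsub>modC M\<^esub> FC a b)
      (\<lambda>x y. (lactE M x (hE y) \<ominus>\<^bsub>modE M\<^esub> lactE M y (hE x) \<ominus>\<^bsub>modE M\<^esub> hE (brE L x y))
         \<oplus>\<^bsub>modE M\<^esub> FE x y)"
proof -
  have lin: "hC \<in> lin_maps R (modC L) (modC M)" "hE \<in> lin_maps R (modE L) (modE M)"
    using h by (auto simp: mackey_morphism_def)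
  then show "has_factors L M X (\<lambda>a. incC X (hC a) \<oplus>\<^bsub>modC (mid X)\<^esub> sC a)
      (\<lambda>x. incE X (hE x) \<oplus>\<^bsub>modE (mid X)\<^esub> sE x)
      (\<lambda>a b. (lactC M a (hC b) \<ominus>\<^bsub>modC M\<^esub> lactC M b (hC a) \<ominus>\<^bsub>modC M\<^esub> hC (brC L a b))
         \<oplus>\<^bsub>modC M\<^esub> FC a b)
      (\<lambda>x y. (lactE M x (hE y) \<ominus>\<^bsub>modE M\<^esub> lactE M y (hE x) \<ominus>\<^bsub>modE M\<^esub> hE (brE L x y))
         \<oplus>\<^bsub>modE M\<^esub> FE x y)"
    by (simp add: has_factors_def FC.factor_of_shift FE.factor_of_shift)
  show "mackey_section R p L X (\<lambda>a. incC X (hC a) \<oplus>\<^bsub>modC (mid X)\<^esub> sC a)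
      (\<lambda>x. incE X (hE x) \<oplus>\<^bsub>modE (mid X)\<^esub> sE x)"
    unfolding mackey_section_def
    by (intro conjI ballI mackey_morphism_add L.mackey_functor_axioms B.mackey_functor_axioms
        section_morphism mackey_morphism_comp[OF h inc_morphism])
      (simp_all add: lin_maps_closed[OF lin(1)] lin_maps_closed[OF lin(2)] SC.j_decomposed
        SE.j_decomposed)
qed

end

lemma green_factorI:
  assumes "green_pair R p L M" "singular_extension R p L M X" "mackey_section R p L X sC sE"
    and "has_factors L M X sC sE FC FE"
  shows "green_factor R p L M X sC sE FC FE"
  using assms by (intro green_factor.intro green_factor_axioms.intro green_section.intro
      green_section_axioms.intro green_extension.intro green_extension_axioms.intro)

section \<open>Factor sets as a complete invariant of an extension\<close>

context green_pair
begin

lemma factor_setsE: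
  assumes "singular_extension R p L M X" "(fC, fE) \<in> factor_sets R p L M X"
  obtains sC sE where "green_factor R p L M X sC sE (\<lambda>a b. fC [a, b]) (\<lambda>x y. fE [x, y])"
    and "fC \<in> extensional (tuples (modC L) 2)" "fE \<in> extensional (tuples (modE L) 2)"
proof -
  obtain sC sE where "mackey_section R p L X sC sE"
      "has_factors L M X sC sE (\<lambda>a b. fC [a, b]) (\<lambda>x y. fE [x, y])"
    and "fC \<in> extensional (tuples (modC L) 2)" "fE \<in> extensional (tuples (modE L) 2)"
    using assms(2) unfolding factor_sets_def by auto
  then show ?thesis
    using green_factorI[OF green_pair_axioms assms(1)] that by blast
qed

lemma factor_sets_nonempty:
  assumes "singular_extension R p L M X" "M_split R p L X"
  shows "factor_sets R p L M X \<noteq> {}"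
proof -
  obtain sC sE where "mackey_section R p L X sC sE"
    using assms(2) by (auto simp: M_split_def mackey_section_def)
  then interpret green_section R p L M X sC sE
    using assms(1) by unfold_locales
  let ?fC = "\<lambda>as\<in>tuples (modC L) 2. SC.retract (brC (mid X) (sC (as ! 0)) (sC (as ! 1)))"
  let ?fE = "\<lambda>xs\<in>tuples (modE L) 2. SE.retract (brE (mid X) (sE (xs ! 0)) (sE (xs ! 1)))"
  have "has_factors L M X sC sE (\<lambda>a b. ?fC [a, b]) (\<lambda>x y. ?fE [x, y])"
    using has_factors_retract by (simp add: has_factors_def factor_of_def)
  then have "(?fC, ?fE) \<in> factor_sets R p L M X"
    using is_section unfolding factor_sets_def by auto
  then show ?thesis by blast
qed

lemma factor_sets_subset_kernel:
  assumes "singular_extension R p L M X"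
  shows "factor_sets R p L M X \<subseteq>
    kernel (cochain_group R p L M 2) (cochain_group R p L M 3) (coboundary L M 2)"
proof
  fix f assume f: "f \<in> factor_sets R p L M X"
  obtain fC fE where feq: "f = (fC, fE)" by (cases f)
  obtain sC sE where gf: "green_factor R p L M X sC sE (\<lambda>a b. fC [a, b]) (\<lambda>x y. fE [x, y])"
    and ext: "fC \<in> extensional (tuples (modC L) 2)" "fE \<in> extensional (tuples (modE L) 2)"
    using factor_setsE[OF assms f[unfolded feq]] .
  interpret green_factor R p L M X sC sE "\<lambda>a b. fC [a, b]" "\<lambda>x y. fE [x, y]" by (rule gf)
  show "f \<in> kernel (cochain_group R p L M 2) (cochain_group R p L M 3) (coboundary L M 2)"
    using ext factors_mackey_bilinear FC.factor_cocycle FE.factor_cocycle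
    unfolding feq kernel_coboundary_iff by blast
qed

lemma factor_sets_eq:
  assumes X: "singular_extension R p L M X" and f: "f \<in> factor_sets R p L M X"
  shows "factor_sets R p L M X = cohomologous_cochains f"
proof -
  obtain fC fE where feq: "f = (fC, fE)" by (cases f)
  obtain sC sE where gf: "green_factor R p L M X sC sE (\<lambda>a b. fC [a, b]) (\<lambda>x y. fE [x, y])"
    using factor_setsE[OF X f[unfolded feq]] .
  interpret green_factor R p L M X sC sE "\<lambda>a b. fC [a, b]" "\<lambda>x y. fE [x, y]" by (rule gf)
  show ?thesis
  proof (intro equalityI subsetI)
    fix g assume "g \<in> cohomologous_cochains f"
    then obtain gC gE hC hE where g: "g = (gC, gE)"
      and ext: "gC \<in> extensional (tuples (modC L) 2)" "gE \<in> extensional (tuples (modE L) 2)"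
      and h: "mackey_morphism R p L M hC hE"
      and eqC: "\<And>a b. \<lbrakk>a \<in> carrier (modC L); b \<in> carrier (modC L)\<rbrakk> \<Longrightarrow> gC [a, b] =
         (lactC M a (hC b) \<ominus>\<^bsub>modC M\<^esub> lactC M b (hC a) \<ominus>\<^bsub>modC M\<^esub> hC (brC L a b))
         \<oplus>\<^bsub>modC M\<^esub> fC [a, b]"
      and eqE: "\<And>x y. \<lbrakk>x \<in> carrier (modE L); y \<in> carrier (modE L)\<rbrakk> \<Longrightarrow> gE [x, y] =
         (lactE M x (hE y) \<ominus>\<^bsub>modE M\<^esub> lactE M y (hE x) \<ominus>\<^bsub>modE M\<^esub> hE (brE L x y))
         \<oplus>\<^bsub>modE M\<^esub> fE [x, y]"
      unfolding cohomologous_cochains_def feq by auto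
    have "has_factors L M X (\<lambda>a. incC X (hC a) \<oplus>\<^bsub>modC (mid X)\<^esub> sC a)
        (\<lambda>x. incE X (hE x) \<oplus>\<^bsub>modE (mid X)\<^esub> sE x) (\<lambda>a b. gC [a, b]) (\<lambda>x y. gE [x, y])"
      using factors_shift(2)[OF h] eqC eqE by (simp add: has_factors_def factor_of_def)
    then show "g \<in> factor_sets R p L M X"
      using factors_shift(1)[OF h] ext unfolding g factor_sets_def by blast
  next
    fix g assume g: "g \<in> factor_sets R p L M X"
    obtain gC gE where geq: "g = (gC, gE)" by (cases g)
    obtain tC tE where gg: "green_factor R p L M X tC tE (\<lambda>a b. gC [a, b]) (\<lambda>x y. gE [x, y])"
      and ext: "gC \<in> extensional (tuples (modC L) 2)" "gE \<in> extensional (tuples (modE L) 2)"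
      using factor_setsE[OF X g[unfolded geq]] .
    interpret G: green_factor R p L M X tC tE "\<lambda>a b. gC [a, b]" "\<lambda>x y. gE [x, y]" by (rule gg)
    \<comment> \<open>As \<open>tC\<close> splits the projection, its retraction is
      \<open>tC - sC\<close> read in \<open>M\<close>. That this difference is a Mackey morphism
      comes from \<open>retract_morphism\<close>.\<close>
    define hC where "hC = (\<lambda>a. SC.retract (tC a))"
    define hE where "hE = (\<lambda>x. SE.retract (tE x))"
    have h: "mackey_morphism R p L M hC hE"
      unfolding hC_def hE_def by (rule mackey_morphism_comp[OF G.section_morphism retract_morphism])
    have tC: "incC X (hC a) \<oplus>\<^bsub>modC (mid X)\<^esub> sC a = tC a" if "a \<in> carrier (modC L)" for a
      using SC.decomposition[of "tC a"] that by (simp add: hC_def G.SC.s_simps G.SC.j_s)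
    have tE: "incE X (hE x) \<oplus>\<^bsub>modE (mid X)\<^esub> sE x = tE x" if "x \<in> carrier (modE L)" for x
      using SE.decomposition[of "tE x"] that by (simp add: hE_def G.SE.s_simps G.SE.j_s)
    note shift = factors_shift(2)[OF h, unfolded has_factors_def]
    \<comment> \<open>The shifted section agrees with \<open>tC\<close> on the carrier, whence the
      congruence rule. Now \<open>tC\<close> has both the shifted factor set and \<open>gC\<close>,
      and these must coincide.\<close>
    have C: "lie_factor R (modC L) (brC L) (modC M) (lactC M) (modC (mid X)) (brC (mid X))
        (incC X) (projC X) tC (\<lambda>a b. (lactC M a (hC b) \<ominus>\<^bsub>modC M\<^esub> lactC M b (hC a) \<ominus>\<^bsub>modC M\<^esub>
          hC (brC L a b)) \<oplus>\<^bsub>modC M\<^esub> fC [a, b])"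
      using shift by unfold_locales (simp add: factor_of_cong[OF L.lie_C tC])
    have E: "lie_factor R (modE L) (brE L) (modE M) (lactE M) (modE (mid X)) (brE (mid X))
        (incE X) (projE X) tE (\<lambda>a b. (lactE M a (hE b) \<ominus>\<^bsub>modE M\<^esub> lactE M b (hE a) \<ominus>\<^bsub>modE M\<^esub>
          hE (brE L a b)) \<oplus>\<^bsub>modE M\<^esub> fE [a, b])"
      using shift by unfold_locales (simp add: factor_of_cong[OF L.lie_E tE])
    show "g \<in> cohomologous_cochains f"
      unfolding cohomologous_cochains_def geq feq
      using ext h factor_of_unique[OF G.FC.lie_factor_axioms C]
        factor_of_unique[OF G.FE.lie_factor_axioms E] by auto
  qed
qed

lemma ext_equivalent_if_factor_set:
  assumes X: "singular_extension R p L M X" and Y: "singular_extension R p L M Y"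
    and fX: "f \<in> factor_sets R p L M X" and fY: "f \<in> factor_sets R p L M Y"
  shows "ext_equivalent R p M X Y"
proof -
  obtain fC fE where feq: "f = (fC, fE)" by (cases f)
  obtain sC sE where gX: "green_factor R p L M X sC sE (\<lambda>a b. fC [a, b]) (\<lambda>x y. fE [x, y])"
    using factor_setsE[OF X fX[unfolded feq]] .
  obtain tC tE where gY: "green_factor R p L M Y tC tE (\<lambda>a b. fC [a, b]) (\<lambda>x y. fE [x, y])"
    using factor_setsE[OF Y fY[unfolded feq]] .
  interpret X: green_factor R p L M X sC sE "\<lambda>a b. fC [a, b]" "\<lambda>x y. fE [x, y]" by (rule gX)
  interpret Y: green_factor R p L M Y tC tE "\<lambda>a b. fC [a, b]" "\<lambda>x y. fE [x, y]" by (rule gY)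
  \<comment> \<open>Coordinates are read off with \<open>sC\<close>, \<open>sE\<close> and
    reassembled with \<open>tC\<close>, \<open>tE\<close>. As a sum of composites of Mackey
    morphisms the result commutes with restriction, transfer and conjugation.\<close>
  let ?\<beta>C = "\<lambda>b. incC Y (X.SC.retract b) \<oplus>\<^bsub>modC (mid Y)\<^esub> tC (projC X b)"
  let ?\<beta>E = "\<lambda>b. incE Y (X.SE.retract b) \<oplus>\<^bsub>modE (mid Y)\<^esub> tE (projE X b)"
  have morphism: "mackey_morphism R p (mid X) (mid Y) ?\<beta>C ?\<beta>E"
    by (intro mackey_morphism_add X.B.mackey_functor_axioms Y.B.mackey_functor_axioms
        mackey_morphism_comp[OF X.retract_morphism Y.inc_morphism]
        mackey_morphism_comp[OF X.proj_morphism Y.section_morphism])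
  note C = lie_factor_isomorphism[OF X.FC.lie_factor_axioms Y.FC.lie_factor_axioms, of ?\<beta>C, OF refl]
  note E = lie_factor_isomorphism[OF X.FE.lie_factor_axioms Y.FE.lie_factor_axioms, of ?\<beta>E, OF refl]
  have "green_lie_morphism R p (mid X) (mid Y) ?\<beta>C ?\<beta>E"
    using morphism C(1) E(1)
    by (auto simp: green_lie_morphism_def lie_homs_def mackey_morphism_def)
  then show ?thesis
    unfolding ext_equivalent_def using C(2-) E(2-) by blast
qed

text \<open>An equivalence carries a section of \<open>X\<close> to one of \<open>Y\<close>, and
  since it matches the two inclusions, the factor set stays the same.\<close>

lemma factor_sets_mono:
  assumes X: "singular_extension R p L M X" and Y: "singular_extension R p L M Y"
    and "ext_equivalent R p M X Y"
  shows "factor_sets R p L M X \<subseteq> factor_sets R p L M Y"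
proof
  fix f assume f: "f \<in> factor_sets R p L M X"
  obtain fC fE where feq: "f = (fC, fE)" by (cases f)
  obtain sC sE where gX: "green_factor R p L M X sC sE (\<lambda>a b. fC [a, b]) (\<lambda>x y. fE [x, y])"
    and ext: "fC \<in> extensional (tuples (modC L) 2)" "fE \<in> extensional (tuples (modE L) 2)"
    using factor_setsE[OF X f[unfolded feq]] .
  interpret X: green_factor R p L M X sC sE "\<lambda>a b. fC [a, b]" "\<lambda>x y. fE [x, y]" by (rule gX)
  obtain \<beta>C \<beta>E where
    \<beta>: "mackey_morphism R p (mid X) (mid Y) \<beta>C \<beta>E"
    and lieC: "\<beta>C \<in> lie_homs R (modC (mid X)) (brC (mid X)) (modC (mid Y)) (brC (mid Y))"
    and lieE: "\<beta>E \<in> lie_homs R (modE (mid X)) (brE (mid X)) (modE (mid Y)) (brE (mid Y))"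
    and inc: "\<And>u. u \<in> carrier (modC M) \<Longrightarrow> \<beta>C (incC X u) = incC Y u"
      "\<And>u. u \<in> carrier (modE M) \<Longrightarrow> \<beta>E (incE X u) = incE Y u"
    and proj: "\<And>b. b \<in> carrier (modC (mid X)) \<Longrightarrow> projC Y (\<beta>C b) = projC X b"
      "\<And>b. b \<in> carrier (modE (mid X)) \<Longrightarrow> projE Y (\<beta>E b) = projE X b"
    using assms(3) unfolding ext_equivalent_def green_lie_morphism_def by auto
  have linC: "\<beta>C \<in> lin_maps R (modC (mid X)) (modC (mid Y))"
    and brC: "\<And>a b. \<lbrakk>a \<in> carrier (modC (mid X)); b \<in> carrier (modC (mid X))\<rbrakk> \<Longrightarrow>
      brC (mid Y) (\<beta>C a) (\<beta>C b) = \<beta>C (brC (mid X) a b)"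
    using lieC by (simp_all add: lie_homs_def)
  have linE: "\<beta>E \<in> lin_maps R (modE (mid X)) (modE (mid Y))"
    and brE: "\<And>a b. \<lbrakk>a \<in> carrier (modE (mid X)); b \<in> carrier (modE (mid X))\<rbrakk> \<Longrightarrow>
      brE (mid Y) (\<beta>E a) (\<beta>E b) = \<beta>E (brE (mid X) a b)"
    using lieE by (simp_all add: lie_homs_def)
  have "mackey_section R p L Y (\<lambda>a. \<beta>C (sC a)) (\<lambda>x. \<beta>E (sE x))"
    unfolding mackey_section_def
    using mackey_morphism_comp[OF X.section_morphism \<beta>]
    by (simp add: proj X.SC.s_simps X.SE.s_simps X.SC.j_s X.SE.j_s)
  moreover have "has_factors L M Y (\<lambda>a. \<beta>C (sC a)) (\<lambda>x. \<beta>E (sE x))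
      (\<lambda>a b. fC [a, b]) (\<lambda>x y. fE [x, y])"
    unfolding has_factors_def factor_of_def
    by (simp add: brC brE X.SC.s_simps X.SE.s_simps X.FC.br_section X.FE.br_section
        X.FC.F_closed X.FE.F_closed lin_maps_add[OF linC] lin_maps_add[OF linE]
        X.CX.i_simps X.EX.i_simps C.br_simps E.br_simps flip: inc)
  ultimately show "f \<in> factor_sets R p L M Y"
    using ext unfolding feq factor_sets_def by blast
qed

end

section \<open>Every cocycle is the factor set of an extension\<close>

text \<open>Only the brackets are twisted. The Mackey structure is the direct sum, as it has to be
  if both the inclusion of \<open>M\<close> and the section sending \<open>a\<close> to
  \<open>(0, a)\<close> are Mackey morphisms.\<close>

definition twisted_functor ::
  "('ma \<times> 'la \<Rightarrow> 'ba) \<Rightarrow> ('mb \<times> 'lb \<Rightarrow> 'bb) \<Rightarrow> ('r, 'la, 'lb, 'y) green_lie_scheme \<Rightarrow>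
   ('r, 'la, 'lb, 'ma, 'mb, 'z) green_bimod_scheme \<Rightarrow>
   ('la \<Rightarrow> 'la \<Rightarrow> 'ma) \<Rightarrow> ('lb \<Rightarrow> 'lb \<Rightarrow> 'mb) \<Rightarrow> ('r, 'ba, 'bb) green_lie" where
  "twisted_functor \<phi>C \<phi>E L M FC FE =
    \<lparr>modC = twisted_module \<phi>C (modC M) (modC L),
     modE = twisted_module \<phi>E (modE M) (modE L),
     res = (\<lambda>a. \<phi>E (map_prod (res M) (res L) (unpack \<phi>C (modC M) (modC L) a))),
     tr = (\<lambda>x. \<phi>C (map_prod (tr M) (tr L) (unpack \<phi>E (modE M) (modE L) x))),
     cj = (\<lambda>g x. \<phi>E (map_prod (cj M g) (cj L g) (unpack \<phi>E (modE M) (modE L) x))),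
     brC = twisted_bracket \<phi>C (modC M) (modC L) (brC L) (lactC M) FC,
     brE = twisted_bracket \<phi>E (modE M) (modE L) (brE L) (lactE M) FE\<rparr>"

definition twisted_extension ::
  "('ma \<times> 'la \<Rightarrow> 'ba) \<Rightarrow> ('mb \<times> 'lb \<Rightarrow> 'bb) \<Rightarrow> ('r, 'la, 'lb, 'y) green_lie_scheme \<Rightarrow>
   ('r, 'la, 'lb, 'ma, 'mb, 'z) green_bimod_scheme \<Rightarrow>
   ('la \<Rightarrow> 'la \<Rightarrow> 'ma) \<Rightarrow> ('lb \<Rightarrow> 'lb \<Rightarrow> 'mb) \<Rightarrow>
   ('r, 'la, 'lb, 'ma, 'mb, 'ba, 'bb) extension" where
  "twisted_extension \<phi>C \<phi>E L M FC FE =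
    \<lparr>mid = twisted_functor \<phi>C \<phi>E L M FC FE,
     incC = (\<lambda>m. \<phi>C (m, \<zero>\<^bsub>modC L\<^esub>)), incE = (\<lambda>u. \<phi>E (u, \<zero>\<^bsub>modE L\<^esub>)),
     projC = (\<lambda>a. snd (unpack \<phi>C (modC M) (modC L) a)),
     projE = (\<lambda>x. snd (unpack \<phi>E (modE M) (modE L) x))\<rparr>"

locale green_cocycle =
  green_pair R p L M
  for R :: "('r, 'x) ring_scheme" and p :: nat
    and L :: "('r, 'la, 'lb, 'y) green_lie_scheme"
    and M :: "('r, 'la, 'lb, 'ma, 'mb, 'z) green_bimod_scheme" +
  fixes \<phi>C :: "'ma \<times> 'la \<Rightarrow> 'ba" and \<phi>E :: "'mb \<times> 'lb \<Rightarrow> 'bb" and FC FE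
  assumes p_pos: "0 < p"
    and inj_C: "inj_on \<phi>C (carrier (modC M) \<times> carrier (modC L))"
    and inj_E: "inj_on \<phi>E (carrier (modE M) \<times> carrier (modE L))"
    and cocycle_C: "lie_2cocycle R (modC L) (brC L) (modC M) (lactC M) FC"
    and cocycle_E: "lie_2cocycle R (modE L) (brE L) (modE M) (lactE M) FE"
    and bilinear: "mackey_bilinear p L M FC FE"
begin

sublocale TC: twisted_lie_extension R "modC L" "brC L" "modC M" "lactC M" \<phi>C FC
  by (intro twisted_lie_extension.intro twisted_lie_extension_axioms.intro transport.intro
      transport_axioms.intro C.lie_pair_axioms L.module_C M.module_C inj_C cocycle_C)

sublocale TE: twisted_lie_extension R "modE L" "brE L" "modE M" "lactE M" \<phi>E FE
  by (intro twisted_lie_extension.intro twisted_lie_extension_axioms.intro transport.intro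
      transport_axioms.intro E.lie_pair_axioms L.module_E M.module_E inj_E cocycle_E)

abbreviation "B \<equiv> twisted_functor \<phi>C \<phi>E L M FC FE"

lemma selectors [simp]:
  "modC B = TC.T" "modE B = TE.T" "brC B = TC.brT" "brE B = TE.brT"
  by (simp_all add: twisted_functor_def)

lemma structure_maps [simp]:
  "\<lbrakk>m \<in> carrier (modC M); a \<in> carrier (modC L)\<rbrakk> \<Longrightarrow> res B (\<phi>C (m, a)) = \<phi>E (res M m, res L a)"
  "\<lbrakk>u \<in> carrier (modE M); x \<in> carrier (modE L)\<rbrakk> \<Longrightarrow> tr B (\<phi>E (u, x)) = \<phi>C (tr M u, tr L x)"
  "\<lbrakk>u \<in> carrier (modE M); x \<in> carrier (modE L)\<rbrakk> \<Longrightarrow>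
    cj B g (\<phi>E (u, x)) = \<phi>E (cj M g u, cj L g x)"
  by (simp_all add: twisted_functor_def)

lemmas L_lin = lin_maps_add[OF L.res_lin] lin_maps_add[OF L.tr_lin] lin_maps_add[OF L.cj_lin]
  lin_maps_smult[OF L.res_lin] lin_maps_smult[OF L.tr_lin] lin_maps_smult[OF L.cj_lin]
  lin_maps_zero[OF L.module_C L.module_E L.res_lin]
  lin_maps_zero[OF L.module_E L.module_C L.tr_lin]
  lin_maps_zero[OF L.module_E L.module_E L.cj_lin]

lemmas M_lin = lin_maps_add[OF M.res_lin] lin_maps_add[OF M.tr_lin] lin_maps_add[OF M.cj_lin]
  lin_maps_smult[OF M.res_lin] lin_maps_smult[OF M.tr_lin] lin_maps_smult[OF M.cj_lin]
  lin_maps_zero[OF M.module_C M.module_E M.res_lin]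
  lin_maps_zero[OF M.module_E M.module_C M.tr_lin]
  lin_maps_zero[OF M.module_E M.module_E M.cj_lin]
  lin_maps_minus[OF M.module_C M.module_E M.res_lin]
  lin_maps_minus[OF M.module_E M.module_C M.tr_lin]
  lin_maps_minus[OF M.module_E M.module_E M.cj_lin]

lemma mackey_functor_twisted: "mackey_functor R p B"
proof (rule mackey_functor.intro)
  note [simp] = L_closed M_closed L_lin M_lin
  show "module R (modC B)" "module R (modE B)"
    by (simp_all add: TC.module_twisted TE.module_twisted)
  show "res B \<in> lin_maps R (modC B) (modE B)"
    by (rule lin_mapsI) (auto elim!: TC.twisted_cases)
  show "tr B \<in> lin_maps R (modE B) (modC B)"
    by (rule lin_mapsI) (auto elim!: TE.twisted_cases)
  show "cj B g \<in> lin_maps R (modE B) (modE B)" if "g \<in> carrier (integer_mod_group p)" for g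
    using that by (intro lin_mapsI) (auto elim!: TE.twisted_cases)
  show "res B (tr B x) = (\<Oplus>\<^bsub>modE B\<^esub>g\<in>carrier (integer_mod_group p). cj B g x)"
    if x: "x \<in> carrier (modE B)" for x
  proof -
    \<comment> \<open>Positivity of \<open>p\<close> makes the group finite, so the sum of
      conjugates can be taken coordinatewise; for \<open>p = 0\<close> the carrier would be all
      integers.\<close>
    have "finite (carrier (integer_mod_group p))"
      using p_pos by (simp add: carrier_integer_mod_group)
    then show ?thesis
      using x by (auto elim!: TE.twisted_cases simp: TE.finsum_twisted L.res_tr M.res_tr Pi_def)
  qed
qed (auto elim!: TC.twisted_cases TE.twisted_cases simp: L_closed M_closed L.cj_res M.cj_res
    L.tr_cj M.tr_cj L.cj_one[simplified] M.cj_one[simplified] L.cj_mult[simplified]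
    M.cj_mult[simplified])

text \<open>The \<open>L\<close> coordinates reproduce the axioms of \<open>L\<close>. In the
  \<open>M\<close> coordinates, the action terms match by the compatibility of the action with the
  structure maps, and the \<open>F\<close> terms by the clauses of
  \<open>mackey_bilinear\<close>.\<close>

lemma green_lie_functor_twisted: "green_lie_functor R p B"
proof (intro green_lie_functor.intro green_lie_functor_axioms.intro mackey_functor_twisted)
  interpret B: mackey_functor R p B by (rule mackey_functor_twisted)
  note [simp] = L_closed M_closed L_lin M_lin C.act_simps(1) E.act_simps(1) C.br_simps(1)
    E.br_simps(1) TC.F_simps(1) TE.F_simps(1)
  have lie: "\<lbrakk>a \<in> carrier (modC L); b \<in> carrier (modC L)\<rbrakk> \<Longrightarrow>
      res L (brC L a b) = brE L (res L a) (res L b)"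
    "\<lbrakk>g \<in> carrier (integer_mod_group p); x \<in> carrier (modE L); y \<in> carrier (modE L)\<rbrakk> \<Longrightarrow>
      cj L g (brE L x y) = brE L (cj L g x) (cj L g y)" for a b g x y
    using L.res_lie L.cj_lie by (auto simp: lie_homs_def)
  note F = bilinear[unfolded mackey_bilinear_def]
  show "lie_algebra R (modC B) (brC B)" "lie_algebra R (modE B) (brE B)"
    by (simp_all add: TC.lie_algebra_twisted TE.lie_algebra_twisted)
  show "res B \<in> lie_homs R (modC B) (brC B) (modE B) (brE B)"
    using B.res_lin F by (auto simp: lie_homs_def lie M.res_lact elim!: TC.twisted_cases)
  show "cj B g \<in> lie_homs R (modE B) (brE B) (modE B) (brE B)"
    if "g \<in> carrier (integer_mod_group p)" for g
    using B.cj_lin[OF that] F that by (auto simp: lie_homs_def lie M.cj_lact elim!: TE.twisted_cases)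
  show "brC B (tr B x) b = tr B (brE B x (res B b))"
    "brC B b (tr B x) = tr B (brE B (res B b) x)"
    if "x \<in> carrier (modE B)" "b \<in> carrier (modC B)" for x b
    using that F by (auto simp: M.tr_lact M.lact_tr L.frobenius_left L.frobenius_right
        elim!: TE.twisted_cases TC.twisted_cases)
qed

abbreviation "X \<equiv> twisted_extension \<phi>C \<phi>E L M FC FE"

lemma extension_selectors [simp]:
  "mid X = B" "incC X = (\<lambda>m. \<phi>C (m, \<zero>\<^bsub>modC L\<^esub>))" "incE X = (\<lambda>u. \<phi>E (u, \<zero>\<^bsub>modE L\<^esub>))"
  "projC X = (\<lambda>a. snd (unpack \<phi>C (modC M) (modC L) a))"
  "projE X = (\<lambda>x. snd (unpack \<phi>E (modE M) (modE L) x))"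
  by (simp_all add: twisted_extension_def)

lemma singular_extension_twisted: "singular_extension R p L M X"
proof -
  have "mackey_morphism R p M B (incC X) (incE X)"
    unfolding mackey_morphism_def using TC.inl_lin TE.inl_lin
    by (simp add: M_closed L_lin)
  moreover have "mackey_morphism R p B L (projC X) (projE X)"
    unfolding mackey_morphism_def using TC.snd_unpack_lin TE.snd_unpack_lin
    by (auto simp: M_closed L_closed elim!: TC.twisted_cases TE.twisted_cases)
  ultimately show ?thesis
    unfolding singular_extension_def green_lie_morphism_def
    using green_lie_functor_twisted TC.j_lie TE.j_lie TC.exact TE.exact TC.abelian TE.abelian
      TC.br_inc TE.br_inc
    by simp
qed

lemma mackey_section_twisted:
  "mackey_section R p L X (\<lambda>a. \<phi>C (\<zero>\<^bsub>modC M\<^esub>, a)) (\<lambda>x. \<phi>E (\<zero>\<^bsub>modE M\<^esub>, x))"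
  unfolding mackey_section_def mackey_morphism_def using TC.inr_lin TE.inr_lin
  by (simp add: L_closed M_lin)

lemma has_factors_twisted:
  "has_factors L M X (\<lambda>a. \<phi>C (\<zero>\<^bsub>modC M\<^esub>, a)) (\<lambda>x. \<phi>E (\<zero>\<^bsub>modE M\<^esub>, x)) FC FE"
  by (simp add: has_factors_def TC.factor_of_twisted TE.factor_of_twisted)

end

section \<open>The classification\<close>

text \<open>\<open>F\<close> is constant on each class, so any chosen representative gives its
  value. A relation of the form "same value under \<open>F\<close>" is an equivalence on
  \<open>S\<close> without further argument, and its classes correspond to the values of
  \<open>F\<close>.\<close>

lemma bij_betw_quotient_kernel:
  "bij_betw (\<lambda>c. F (SOME x. x \<in> c)) (S // {(x, y). x \<in> S \<and> y \<in> S \<and> F x = F y}) (F ` S)"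
proof -
  let ?E = "{(x, y). x \<in> S \<and> y \<in> S \<and> F x = F y}"
  have F_some: "F (SOME y. y \<in> ?E `` {x}) = F x" if "x \<in> S" for x
  proof -
    have "x \<in> ?E `` {x}" using that by simp
    then have "(SOME y. y \<in> ?E `` {x}) \<in> ?E `` {x}" by (rule someI)
    then show ?thesis using that by simp
  qed
  show ?thesis
  proof (rule bij_betwI')
    fix c d assume "c \<in> S // ?E" "d \<in> S // ?E"
    then obtain x y where xy: "x \<in> S" "c = ?E `` {x}" "y \<in> S" "d = ?E `` {y}"
      by (auto elim!: quotientE)
    then show "F (SOME x. x \<in> c) = F (SOME x. x \<in> d) \<longleftrightarrow> c = d"
      using F_some by auto
  next
    fix c assume "c \<in> S // ?E"
    then obtain x where "x \<in> S" "c = ?E `` {x}"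
      by (rule quotientE)
    then show "F (SOME x. x \<in> c) \<in> F ` S"
      by (simp only: F_some imageI)
  next
    fix z assume "z \<in> F ` S"
    then obtain x where "x \<in> S" "z = F x"
      by blast
    then show "\<exists>c\<in>S // ?E. z = F (SOME x. x \<in> c)"
      by (intro bexI[of _ "?E `` {x}"] quotientI) (simp_all only: F_some)
  qed
qed

theorem theorem7p7:
  fixes R :: "('r, 'x) ring_scheme"
    and p :: nat
    and L :: "('r, 'la, 'lb) green_lie"
    and M :: "('r, 'la, 'lb, 'ma, 'mb) green_bimod"
  assumes "cring R" and "char_zero R"
    and "prime p"
    and "green_lie_functor R p L"
    and "green_bimodule R p L M"
    and universe_C: "carrier (modC M) \<times> carrier (modC L) \<lesssim> (UNIV :: 'ba set)"
    and universe_E: "carrier (modE M) \<times> carrier (modE L) \<lesssim> (UNIV :: 'bb set)"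
  shows "\<exists>\<Phi>. bij_betw \<Phi>
    (Ext R p L M :: ('r, 'la, 'lb, 'ma, 'mb, 'ba, 'bb) extension set set)
    (carrier (H2_Green_Lie R p L M))"
proof -
  interpret green_pair R p L M
    using assms(4,5) by (simp add: green_pair_def green_bimodule_def)
  \<comment> \<open>Any injection serves: it only transports the twisted product into the prescribed
    type.\<close>
  obtain \<phi>C :: "'ma \<times> 'la \<Rightarrow> 'ba" where \<phi>C: "inj_on \<phi>C (carrier (modC M) \<times> carrier (modC L))"
    using universe_C by (auto simp: lepoll_def)
  obtain \<phi>E :: "'mb \<times> 'lb \<Rightarrow> 'bb" where \<phi>E: "inj_on \<phi>E (carrier (modE M) \<times> carrier (modE L))"
    using universe_E by (auto simp: lepoll_def)
  define S :: "('r, 'la, 'lb, 'ma, 'mb, 'ba, 'bb) extension set"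
    where "S = {X. singular_extension R p L M X \<and> M_split R p L X}"
  define Z where "Z = kernel (cochain_group R p L M 2) (cochain_group R p L M 3) (coboundary L M 2)"
  let ?F = "factor_sets R p L M"
  have ne: "\<exists>f. f \<in> ?F X" if "X \<in> S" for X
    using factor_sets_nonempty that unfolding S_def by blast
  have realised: "\<exists>X\<in>S. f \<in> ?F X" if "f \<in> Z" for f
  proof -
    obtain fC fE where f: "f = (fC, fE)" by (cases f)
    have Z: "(fC, fE) \<in> kernel (cochain_group R p L M 2) (cochain_group R p L M 3) (coboundary L M 2)"
      using that by (simp add: f Z_def)
    note cocycle = Z[unfolded kernel_coboundary_iff]
    interpret T: green_cocycle R p L M \<phi>C \<phi>E "\<lambda>a b. fC [a, b]" "\<lambda>x y. fE [x, y]"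
      using cocycle \<phi>C \<phi>E prime_gt_0_nat[OF \<open>prime p\<close>] by unfold_locales auto
    have "T.X \<in> S"
      using T.singular_extension_twisted T.mackey_section_twisted
      unfolding S_def M_split_def mackey_section_def by blast
    moreover have "f \<in> ?F T.X"
      using cocycle T.mackey_section_twisted T.has_factors_twisted
      unfolding f factor_sets_def by blast
    ultimately show ?thesis by blast
  qed
  \<comment> \<open>This identifies the relation in \<open>Ext\<close> with the kernel of
    \<open>factor_sets\<close>.\<close>
  have equivalent_iff: "ext_equivalent R p M X Y \<longleftrightarrow> ?F X = ?F Y" if XY: "X \<in> S" "Y \<in> S" for X Y
  proof
    have X: "singular_extension R p L M X" and Y: "singular_extension R p L M Y"
      using XY by (auto simp: S_def)
    obtain f where f: "f \<in> ?F X" using ne[OF XY(1)] by blast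
    \<comment> \<open>Containment in one direction is enough: it puts \<open>f\<close> into both
      sets, and each of them is the coset of \<open>f\<close>.\<close>
    show "?F X = ?F Y" if "ext_equivalent R p M X Y"
      using factor_sets_mono[OF X Y that] f factor_sets_eq[OF X] factor_sets_eq[OF Y] by blast
    show "ext_equivalent R p M X Y" if "?F X = ?F Y"
      using ext_equivalent_if_factor_set[OF X Y] f that by simp
  qed
  \<comment> \<open>Factor sets of extensions are cocycles, which gives one inclusion; the other
    takes its extension from \<open>realised\<close>.\<close>
  have "?F ` S = cohomologous_cochains ` Z"
  proof (intro equalityI subsetI)
    fix c assume "c \<in> ?F ` S"
    then obtain X where X: "X \<in> S" "c = ?F X" by blast
    obtain f where f: "f \<in> ?F X" using ne[OF X(1)] by blast
    have ext: "singular_extension R p L M X" using X(1) by (simp add: S_def)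
    have "f \<in> Z" using factor_sets_subset_kernel[OF ext] f by (auto simp: Z_def)
    then show "c \<in> cohomologous_cochains ` Z"
      using X(2) factor_sets_eq[OF ext f] by simp
  next
    fix c assume "c \<in> cohomologous_cochains ` Z"
    then obtain f where f: "f \<in> Z" "c = cohomologous_cochains f" by blast
    obtain X where X: "X \<in> S" "f \<in> ?F X" using realised[OF f(1)] by blast
    have "singular_extension R p L M X" using X(1) by (simp add: S_def)
    then have "c = ?F X" using f(2) factor_sets_eq[OF _ X(2)] by simp
    then show "c \<in> ?F ` S" using X(1) by blast
  qed
  moreover have "Ext R p L M = S // {(X, Y). X \<in> S \<and> Y \<in> S \<and> ?F X = ?F Y}"
  proof -
    have "{(X, Y). X \<in> S \<and> Y \<in> S \<and> ?F X = ?F Y} =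
        {(X, Y). X \<in> S \<and> Y \<in> S \<and> ext_equivalent R p M X Y}"
      using equivalent_iff by blast
    then show ?thesis
      unfolding Ext_def S_def by simp
  qed
  ultimately show ?thesis
    using bij_betw_quotient_kernel[of ?F S] by (auto simp: carrier_H2 Z_def)
qed

end
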